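(* Let $\mathfrak A$ be a unital JB-algebra and let $\lambda\in(0,1)$. Each of the following four maps $\mathfrak A_{++}\times\mathfrak A_{++}\to\mathfrak A_{++}$ is a two-variable Lie-Trotter mean (with weight $\lambda$) in $\mathfrak A$: the weighted arithmetic mean $(A,B)\mapsto(1-\lambda)A+\lambda B$; the weighted harmonic mean $(A,B)\mapsto\left((1-\lambda)A^{-1}+\lambda B^{-1}\right)^{-1}$; the weighted geometric mean $(A,B)\mapsto A\#_\lambda B$; and the weighted spectral geometric mean $(A,B)\mapsto A\natural_\lambda B$. In particular, for all differentiable curves $\gamma_1,\gamma_2:(-\varepsilon,\varepsilon)\to\mathfrak A_{++}$ with $\gamma_1(0)=\gamma_2(0)=I$, \begin{align*} \exp[(1-\lambda)\gamma_1'(0)+\lambda\gamma_2'(0)]&=\lim_{t\to0}[(1-\lambda)\gamma_1(t)+\lambda\gamma_2(t)]^{1/t}\\ &=\lim_{t\to0}[(1-\lambda)\gamma_1(t)^{-1}+\lambda\gamma_2(t)^{-1}]^{-1/t}\\ &=\lim_{t\to0}[\gamma_1(t)\#_\lambda\gamma_2(t)]^{1/t}\\ &=\lim_{t\to0}[\gamma_1(t)\natural_\lambda\gamma_2(t)]^{1/t}. \end{align*}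
   Context: A (real) Jordan algebra is a real vector space $\mathfrak A$ with a bilinear product $\circ$ satisfying $A\circ B=B\circ A$ and $(A^2\circ B)\circ A=A^2\circ(B\circ A)$, where $A^2=A\circ A$. A JB-algebra is a Jordan algebra over $\mathbb R$ with a complete norm such that $\|A\circ B\|\le\|A\|\|B\|$, $\|A^2\|=\|A\|^2$ and $\|A^2\|\le\|A^2+B^2\|$. In a unital JB-algebra with unit $I$, $A$ is invertible with (Jordan) inverse $B=A^{-1}$ if $A\circ B=I$ and $A^2\circ B=A$; the spectrum of $A$ is $\{\lambda\in\mathbb R: A-\lambda I \text{ is not invertible}\}$; $A$ is positive ($A\ge0$) if its spectrum lies in $[0,\infty)$. $\mathfrak A_{++}$ is the open convex cone of positive invertible elements. Real powers, $\exp$ and $\log$ are given by functional calculus in $\mathfrak A$. The triple product is $\{ABA\}:=2(A\circ B)\circ A-A^2\circ B$. For $A,B\in\mathfrak A_{++}$ the weighted geometric mean is $A\#_\lambda B=\{A^{1/2}\{A^{-1/2}BA^{-1/2}\}^{\lambda}A^{1/2}\}$, with $A\#B:=A\#_{1/2}B$, and the weighted spectral geometric mean is $A\natural_\lambda B=\{(A^{-1}\#B)^\lambda A(A^{-1}\#B)^\lambda\}$. For $\lambda\in(0,1)$, a weighted 2-mean in $\mathfrak A$ is a map $G_2(1-\lambda,\lambda;\cdot):\mathfrak A_{++}\times\mathfrak A_{++}\to\mathfrak A_{++}$ with $G_2(1-\lambda,\lambda;A,A)=A$ for all $A\in\mathfrak A_{++}$. A two-variable Lie-Trotter mean is a weighted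 2-mean $G_2(1-\lambda,\lambda;\cdot)$ that is differentiable and satisfies $\lim_{t\to0}G_2(1-\lambda,\lambda;\gamma_1(t),\gamma_2(t))^{1/t}=\exp[(1-\lambda)\gamma_1'(0)+\lambda\gamma_2'(0)]$ for all differentiable curves $\gamma_1,\gamma_2:(-\varepsilon,\varepsilon)\to\mathfrak A_{++}$ with $\gamma_1(0)=\gamma_2(0)=I$. *)

theory Defs
  imports "HOL-Analysis.Analysis" "HOL-Computational_Algebra.Polynomial"
begin

class unital_jb_algebra = banach + one +
  fixes jprod :: "'a \<Rightarrow> 'a \<Rightarrow> 'a"  (infixl "\<odot>" 70)
  assumes jprod_commute: "a \<odot> b = b \<odot> a"
    and jprod_add_left: "(a + b) \<odot> c = a \<odot> c + b \<odot> c"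
    and jprod_scaleR_left: "(r *\<^sub>R a) \<odot> b = r *\<^sub>R (a \<odot> b)"
    and jordan_identity: "((a \<odot> a) \<odot> b) \<odot> a = (a \<odot> a) \<odot> (b \<odot> a)"
    and jprod_one_left: "1 \<odot> a = a"
    and norm_jprod_le: "norm (a \<odot> b) \<le> norm a * norm b"
    and norm_jsquare: "norm (a \<odot> a) = norm a ^ 2"
    and norm_jsquare_le: "norm (a \<odot> a) \<le> norm (a \<odot> a + b \<odot> b)"

definition is_jinverse :: "'a::unital_jb_algebra \<Rightarrow> 'a \<Rightarrow> bool" where
  "is_jinverse A B \<longleftrightarrow> A \<odot> B = 1 \<and> (A \<odot> A) \<odot> B = A"

definition jinvertible :: "'a::unital_jb_algebra \<Rightarrow> bool" where
  "jinvertible A \<longleftrightarrow> (\<exists>B. is_jinverse A B)"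

text \<open>Jordan inverses are unique, so the description below is proper for invertible elements.\<close>

definition jinv :: "'a::unital_jb_algebra \<Rightarrow> 'a" where
  "jinv A = (THE B. is_jinverse A B)"

definition jspectrum :: "'a::unital_jb_algebra \<Rightarrow> real set" where
  "jspectrum A = {r. \<not> jinvertible (A - r *\<^sub>R 1)}"

definition jpositive :: "'a::unital_jb_algebra \<Rightarrow> bool" where
  "jpositive A \<longleftrightarrow> jspectrum A \<subseteq> {0..}"

definition jpos_cone :: "'a::unital_jb_algebra set" where
  "jpos_cone = {A. jpositive A \<and> jinvertible A}"

primrec jpower :: "'a::unital_jb_algebra \<Rightarrow> nat \<Rightarrow> 'a" where
  "jpower A 0 = 1"
| "jpower A (Suc n) = A \<odot> jpower A n"

definition jpoly :: "real poly \<Rightarrow> 'a::unital_jb_algebra \<Rightarrow> 'a" where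
  "jpoly p A = (\<Sum>i\<le>degree p. coeff p i *\<^sub>R jpower A i)"

text \<open>
  Continuous functional calculus: \<open>f(A)\<close> is the norm limit of \<open>p\<^sub>n(A)\<close> for polynomials
  \<open>p\<^sub>n\<close> converging to \<open>f\<close> uniformly on the spectrum of \<open>A\<close>. For \<open>f\<close> continuous on the
  (compact) spectrum such polynomials exist by Weierstrass, and the limit exists and does not
  depend on their choice because the norm of \<open>p(A)\<close> is the supremum of \<open>\<bar>p\<bar>\<close> over the
  spectrum. For other \<open>f\<close> the value is unspecified.
\<close>

definition jfun_calc :: "(real \<Rightarrow> real) \<Rightarrow> 'a::unital_jb_algebra \<Rightarrow> 'a" where
  "jfun_calc f A = (THE B. \<exists>p :: nat \<Rightarrow> real poly.
     uniform_limit (jspectrum A) (\<lambda>n. poly (p n)) f sequentially \<and>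
     (\<lambda>n. jpoly (p n) A) \<longlonglongrightarrow> B)"

definition jexp :: "'a::unital_jb_algebra \<Rightarrow> 'a" where
  "jexp A = jfun_calc exp A"

definition jpowr :: "'a::unital_jb_algebra \<Rightarrow> real \<Rightarrow> 'a"  (infixr "jpowr" 80) where
  "A jpowr r = jfun_calc (\<lambda>x. x powr r) A"

text \<open>\<open>jtriple A B\<close> is the triple product \<open>{ABA}\<close>.\<close>

definition jtriple :: "'a::unital_jb_algebra \<Rightarrow> 'a \<Rightarrow> 'a" where
  "jtriple A B = 2 *\<^sub>R ((A \<odot> B) \<odot> A) - (A \<odot> A) \<odot> B"

definition arith_mean :: "real \<Rightarrow> 'a::unital_jb_algebra \<Rightarrow> 'a \<Rightarrow> 'a" where
  "arith_mean l A B = (1 - l) *\<^sub>R A + l *\<^sub>R B"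

definition harm_mean :: "real \<Rightarrow> 'a::unital_jb_algebra \<Rightarrow> 'a \<Rightarrow> 'a" where
  "harm_mean l A B = jinv ((1 - l) *\<^sub>R jinv A + l *\<^sub>R jinv B)"

definition geo_mean :: "real \<Rightarrow> 'a::unital_jb_algebra \<Rightarrow> 'a \<Rightarrow> 'a" where
  "geo_mean l A B = jtriple (A jpowr (1/2)) ((jtriple (A jpowr (-1/2)) B) jpowr l)"

definition spectral_geo_mean :: "real \<Rightarrow> 'a::unital_jb_algebra \<Rightarrow> 'a \<Rightarrow> 'a" where
  "spectral_geo_mean l A B = jtriple ((geo_mean (1/2) (jinv A) B) jpowr l) A"

text \<open>A differentiable curve \<open>(-e, e) \<rightarrow> jpos_cone\<close> through the unit at \<open>0\<close>; values outside
  the interval are irrelevant.\<close>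

definition unit_curve :: "real \<Rightarrow> (real \<Rightarrow> 'a::unital_jb_algebra) \<Rightarrow> bool" where
  "unit_curve e \<gamma> \<longleftrightarrow> \<gamma> \<in> {-e<..<e} \<rightarrow> jpos_cone \<and> \<gamma> differentiable_on {-e<..<e} \<and> \<gamma> 0 = 1"

text \<open>For a weight \<open>l\<close>, the map \<open>G\<close> below is \<open>G\<^sub>2(1 - l, l; \<cdot>)\<close>; the notion of a weighted
  2-mean itself does not otherwise involve \<open>l\<close>. Only values on the cone matter.\<close>

definition weighted_two_mean :: "('a::unital_jb_algebra \<Rightarrow> 'a \<Rightarrow> 'a) \<Rightarrow> bool" where
  "weighted_two_mean G \<longleftrightarrow>
     (\<forall>A\<in>jpos_cone. \<forall>B\<in>jpos_cone. G A B \<in> jpos_cone) \<and> (\<forall>A\<in>jpos_cone. G A A = A)"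

text \<open>Differentiability is joint Frechet differentiability on the product of the (open) cones.\<close>

definition lie_trotter_mean :: "real \<Rightarrow> ('a::unital_jb_algebra \<Rightarrow> 'a \<Rightarrow> 'a) \<Rightarrow> bool" where
  "lie_trotter_mean l G \<longleftrightarrow>
     0 < l \<and> l < 1 \<and> weighted_two_mean G \<and>
     (\<lambda>(A, B). G A B) differentiable_on (jpos_cone \<times> jpos_cone) \<and>
     (\<forall>e>0. \<forall>\<gamma>1 \<gamma>2. unit_curve e \<gamma>1 \<and> unit_curve e \<gamma>2 \<longrightarrow>
        ((\<lambda>t. G (\<gamma>1 t) (\<gamma>2 t) jpowr (1 / t)) \<longlongrightarrow>
          jexp ((1 - l) *\<^sub>R vector_derivative \<gamma>1 (at 0) + l *\<^sub>R vector_derivative \<gamma>2 (at 0))) (at 0))"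

end

theory Submission
  imports Defs "HOL-Computational_Algebra.Fundamental_Theorem_Algebra"
begin

text \<open>
  Two facts make the theorem true. A curve with \<open>X 0 = 1\<close> and \<open>X' 0 = W\<close> satisfies
  \<open>X t jpowr (c / t) \<longlongrightarrow> jexp (c *\<^sub>R W)\<close>, since the power is the exponential of \<open>(c / t) log X t\<close>
  and the logarithm has the identity as derivative at \<open>1\<close> (lemma \<open>jpowr_tendsto_jexp\<close>). And
  along two curves through \<open>1\<close> each mean has derivative \<open>(1 - l) \<gamma>\<^sub>1' 0 + l \<gamma>\<^sub>2' 0\<close>, because
  \<open>A jpowr r\<close> has derivative \<open>h \<mapsto> r h\<close> at \<open>1\<close> and \<open>{ABA}\<close> has derivative \<open>(h, k) \<mapsto> 2 h + k\<close> at
  \<open>(1, 1)\<close>. What remains is that the functional calculus behaves as expected, that powers are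
  Frechet differentiable on the cone, and that \<open>{ABA}\<close> stays in the cone.

  \<^bold>\<open>Functional calculus.\<close> The linearized Jordan identity yields the recurrence
  \<open>L(a\<^sup>n\<^sup>+\<^sup>2) = 2 L(a) L(a\<^sup>n\<^sup>+\<^sup>1) - U(a) L(a\<^sup>n)\<close> for the multiplications \<open>L\<close> and \<open>U(a) b = {aba}\<close>. Hence
  the closed subalgebra \<open>jgen a\<close> generated by \<open>a\<close> is associative and acts by commuting operators,
  and \<open>U(a x) = U(a) U(x)\<close> for \<open>x \<in> jgen a\<close>; this multiplicativity replaces the fundamental formula
  throughout. If \<open>B\<close> is a Jordan inverse of \<open>a\<close> then \<open>U(a) B\<^sup>2 = 1\<close>, so that \<open>g\<^sup>2 = U(a g) B\<^sup>2\<close> for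
  \<open>g \<in> jgen a\<close>: an element \<open>a\<close> with approximate null vectors in \<open>jgen a\<close> has no Jordan inverse.
  Thus invertibility may be tested in \<open>jgen a\<close> (\<open>jinverse_imp_jgen_inverse\<close>). Square roots
  of \<open>1 - y\<close> and the norm axioms show that \<open>\<parallel>x\<^sup>2\<parallel> - x\<^sup>2\<close> is not
  invertible in \<open>jgen a\<close> when \<open>1 \<noteq> 0\<close>. Factoring a real polynomial into linear factors and sums of two squares then turns this into
  \<open>\<parallel>p(a)\<parallel> \<le> sup \<bar>p\<bar>\<close> over the spectrum (\<open>norm_jpoly_le\<close>), and Weierstrass approximation gives
  the calculus with its homomorphism and composition rules.

  \<^bold>\<open>Positivity of the triple product.\<close> For \<open>x \<ge> 0\<close>, expanding the square of
  \<open>x / \<surd>\<parallel>x\<parallel> + \<surd>\<parallel>x\<parallel> h\<close> and using \<open>x\<^sup>2 \<le> \<parallel>x\<parallel> x\<close> gives \<open>x + 2 h \<odot> x \<ge> - \<parallel>x\<parallel> \<parallel>h\<parallel>\<^sup>2\<close>. So \<open>U(1 + h)\<close> is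
  positive up to an error of second order in \<open>h\<close>. Write \<open>A\<close> as the \<open>N\<close>-th power of its root
  \<open>1 + h\<close>, with \<open>N = 2\<^sup>k\<close> and \<open>h = O(1 / N)\<close>; then \<open>U(A) = U(1 + h)\<^sup>N\<close> is positive up to \<open>O(1 / N)\<close>, hence
  positive (\<open>jpositive_jtriple\<close>).

  \<^bold>\<open>Differentiability.\<close> On the cone \<open>A\<close> can be rescaled so that \<open>\<parallel>A / M - 1\<parallel> < 1\<close>; there \<open>A jpowr r\<close>
  is a binomial series in Jordan powers, and the derivative of \<open>x \<mapsto> x\<^sup>n\<close> is bounded by \<open>n \<parallel>x\<parallel>\<^sup>n\<^sup>-\<^sup>1\<close>
  as for commuting variables, so the series may be differentiated termwise.
\<close>

section \<open>The linearized Jordan identity and powers of one element\<close>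

lemma jprod_add_right: "a \<odot> (b + c) = a \<odot> b + a \<odot> (c::'a::unital_jb_algebra)"
  by (metis jprod_add_left jprod_commute)

lemma jprod_scaleR_right: "a \<odot> (r *\<^sub>R b) = r *\<^sub>R (a \<odot> (b::'a::unital_jb_algebra))"
  by (metis jprod_scaleR_left jprod_commute)

interpretation jprod: bounded_bilinear "(\<odot>) :: 'a::unital_jb_algebra \<Rightarrow> 'a \<Rightarrow> 'a"
proof
  show "\<exists>K. \<forall>a b::'a. norm (a \<odot> b) \<le> norm a * norm b * K"
    by (rule exI[of _ 1]) (simp add: norm_jprod_le)
qed (simp_all add: jprod_add_left jprod_add_right jprod_scaleR_left jprod_scaleR_right)

lemma jprod_one_right [simp]: "a \<odot> 1 = (a::'a::unital_jb_algebra)"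
  by (metis jprod_commute jprod_one_left)

declare jprod_one_left [simp]

lemmas jprod_lin = jprod.add_left jprod.add_right jprod.diff_left jprod.diff_right
  jprod.minus_left jprod.minus_right jprod.scaleR_left jprod.scaleR_right
  jprod.zero_left jprod.zero_right

text \<open>The full polarization of the Jordan identity, which is cubic in its first variable. It is used
  in two readings: as a statement about commutators when \<open>b\<close> is the argument, and as a formula for
  the multiplication by \<open>(a \<odot> c) \<odot> b\<close> when \<open>d\<close> is the argument.\<close>

lemma jordan_linearized:
  fixes a b c d :: "'a::unital_jb_algebra"
  shows "(a \<odot> d) \<odot> (b \<odot> c) + (a \<odot> c) \<odot> (b \<odot> d) + (d \<odot> c) \<odot> (b \<odot> a)
       = ((a \<odot> d) \<odot> b) \<odot> c + ((a \<odot> c) \<odot> b) \<odot> d + ((d \<odot> c) \<odot> b) \<odot> a"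
proof -
  have P: "(x \<odot> x) \<odot> (b \<odot> c) + 2 *\<^sub>R ((x \<odot> c) \<odot> (b \<odot> x))
      = ((x \<odot> x) \<odot> b) \<odot> c + 2 *\<^sub>R (((x \<odot> c) \<odot> b) \<odot> x)" for x :: 'a
  proof -
    have E1: "((x + c) \<odot> (x + c) \<odot> b) \<odot> (x + c) = ((x + c) \<odot> (x + c)) \<odot> (b \<odot> (x + c))"
      by (rule jordan_identity)
    have E2: "((x - c) \<odot> (x - c) \<odot> b) \<odot> (x - c) = ((x - c) \<odot> (x - c)) \<odot> (b \<odot> (x - c))"
      by (rule jordan_identity)
    have E3: "((x \<odot> x) \<odot> b) \<odot> x = (x \<odot> x) \<odot> (b \<odot> x)" by (rule jordan_identity)
    have E4: "((c \<odot> c) \<odot> b) \<odot> c = (c \<odot> c) \<odot> (b \<odot> c)" by (rule jordan_identity)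
    have cx: "c \<odot> x = x \<odot> c" by (rule jprod_commute)
    \<comment> \<open>The part of odd degree in \<open>c\<close> of the identity at \<open>x + c\<close>, with the cubic term removed.\<close>
    have "((x + c) \<odot> (x + c) \<odot> b) \<odot> (x + c) - ((x - c) \<odot> (x - c) \<odot> b) \<odot> (x - c)
          - 2 *\<^sub>R (((c \<odot> c) \<odot> b) \<odot> c)
        = ((x + c) \<odot> (x + c)) \<odot> (b \<odot> (x + c)) - ((x - c) \<odot> (x - c)) \<odot> (b \<odot> (x - c))
          - 2 *\<^sub>R ((c \<odot> c) \<odot> (b \<odot> c))"
      by (simp only: E1 E2 E4)
    then have "2 *\<^sub>R ((x \<odot> x) \<odot> (b \<odot> c) + 2 *\<^sub>R ((x \<odot> c) \<odot> (b \<odot> x)))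
        = 2 *\<^sub>R (((x \<odot> x) \<odot> b) \<odot> c + 2 *\<^sub>R (((x \<odot> c) \<odot> b) \<odot> x))"
      by (simp add: jprod_lin cx scaleR_2 algebra_simps)
    then show ?thesis by simp
  qed
  let ?l = "\<lambda>x. (x \<odot> x) \<odot> (b \<odot> c) + 2 *\<^sub>R ((x \<odot> c) \<odot> (b \<odot> x))"
  let ?r = "\<lambda>x. ((x \<odot> x) \<odot> b) \<odot> c + 2 *\<^sub>R (((x \<odot> c) \<odot> b) \<odot> x)"
  have "?l (a + d) - ?l a - ?l d = ?r (a + d) - ?r a - ?r d" by (simp only: P)
  then have "2 *\<^sub>R ((a \<odot> d) \<odot> (b \<odot> c) + (a \<odot> c) \<odot> (b \<odot> d) + (d \<odot> c) \<odot> (b \<odot> a))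
       = 2 *\<^sub>R (((a \<odot> d) \<odot> b) \<odot> c + ((a \<odot> c) \<odot> b) \<odot> d + ((d \<odot> c) \<odot> b) \<odot> a)"
    using jprod_commute[of d a] by (simp add: jprod_lin scaleR_2 algebra_simps)
  then show ?thesis by simp
qed

text \<open>The polarization of \<open>jtriple\<close> in its outer variable, i.e. the Jordan triple product \<open>{x b y}\<close>.\<close>

definition jtri :: "'a::unital_jb_algebra \<Rightarrow> 'a \<Rightarrow> 'a \<Rightarrow> 'a" where
  "jtri x y b = x \<odot> (y \<odot> b) + y \<odot> (x \<odot> b) - (x \<odot> y) \<odot> b"

lemma jtri_same: "jtri x x b = jtriple x b"
  by (simp add: jtri_def jtriple_def scaleR_2 jprod_commute)

lemma jtriple_alt: "jtriple x b = 2 *\<^sub>R (x \<odot> (x \<odot> b)) - (x \<odot> x) \<odot> b"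
  by (simp add: jtriple_def jprod_commute)

lemma bounded_linear_jtriple: "bounded_linear (jtriple a)"
proof -
  have "bounded_linear (\<lambda>b. 2 *\<^sub>R (a \<odot> (a \<odot> b)) - (a \<odot> a) \<odot> b)"
    by (intro bounded_linear_sub bounded_linear_const_scaleR jprod.bounded_linear_right
        bounded_linear_compose[OF jprod.bounded_linear_right jprod.bounded_linear_right])
  then show ?thesis by (simp add: jtriple_alt[abs_def])
qed

lemma jtriple_lin:
  "jtriple a (x + y) = jtriple a x + jtriple a y"
  "jtriple a (x - y) = jtriple a x - jtriple a y"
  "jtriple a (r *\<^sub>R x) = r *\<^sub>R jtriple a x"
  "jtriple a 0 = 0" "jtriple a (- x) = - jtriple a x"
  using bounded_linear.linear[OF bounded_linear_jtriple[of a]]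
  by (simp_all add: linear_add linear_diff linear_scale linear_0 linear_neg)

lemma jordan_left_commute:
  fixes a x :: "'a::unital_jb_algebra"
  shows "a \<odot> ((a \<odot> a) \<odot> x) = (a \<odot> a) \<odot> (a \<odot> x)"
  using jordan_identity[of a x] by (metis jprod_commute)

text \<open>With \<open>L\<close> for multiplications and \<open>U\<close> for \<open>jtriple a\<close>, the linearized identity at \<open>(a, a, a\<^sup>n)\<close>
  expresses \<open>L(a\<^sup>n\<^sup>+\<^sup>2)\<close> through \<open>L(a)\<close>, \<open>L(a\<^sup>2)\<close>, \<open>L(a\<^sup>n)\<close> and \<open>L(a\<^sup>n\<^sup>+\<^sup>1)\<close>. Commutation with \<open>L(a)\<close> and \<open>L(a\<^sup>2)\<close>
  is what brings this into the form of a two-term recurrence, so both are proved in one induction.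
  In an associative algebra the recurrence says that left and right multiplication by \<open>a\<close> are the
  two roots of \<open>T\<^sup>2 - 2 L(a) T + U = 0\<close>.\<close>

lemma jpower_commute_base:
  fixes a :: "'a::unital_jb_algebra"
  shows "(\<forall>x. jpower a n \<odot> (a \<odot> x) = a \<odot> (jpower a n \<odot> x)
        \<and> jpower a n \<odot> ((a \<odot> a) \<odot> x) = (a \<odot> a) \<odot> (jpower a n \<odot> x))
     \<and> (\<forall>x. jpower a (Suc n) \<odot> (a \<odot> x) = a \<odot> (jpower a (Suc n) \<odot> x)
        \<and> jpower a (Suc n) \<odot> ((a \<odot> a) \<odot> x) = (a \<odot> a) \<odot> (jpower a (Suc n) \<odot> x))
     \<and> (\<forall>x. jpower a (Suc (Suc n)) \<odot> x
          = 2 *\<^sub>R (a \<odot> (jpower a (Suc n) \<odot> x)) - jtriple a (jpower a n \<odot> x))"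
proof (induction n)
  case 0
  show ?case by (simp add: jordan_left_commute jtriple_alt)
next
  case (Suc n)
  let ?p = "jpower a n" and ?q = "jpower a (Suc n)" and ?r = "jpower a (Suc (Suc n))"
    and ?s = "jpower a (Suc (Suc (Suc n)))"
  have q1: "?q \<odot> (a \<odot> x) = a \<odot> (?q \<odot> x)" and q2: "?q \<odot> ((a \<odot> a) \<odot> x) = (a \<odot> a) \<odot> (?q \<odot> x)" for x
    using Suc by auto
  have p1: "?p \<odot> (a \<odot> x) = a \<odot> (?p \<odot> x)" and p2: "?p \<odot> ((a \<odot> a) \<odot> x) = (a \<odot> a) \<odot> (?p \<odot> x)" for x
    using Suc by auto
  have r: "?r \<odot> x = 2 *\<^sub>R (a \<odot> (?q \<odot> x)) - jtriple a (?p \<odot> x)" for x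
    using Suc by blast
  have r1: "?r \<odot> (a \<odot> x) = a \<odot> (?r \<odot> x)" for x
    unfolding r jtriple_alt q1 p1 by (simp only: jprod_lin jordan_left_commute)
  have r2: "?r \<odot> ((a \<odot> a) \<odot> x) = (a \<odot> a) \<odot> (?r \<odot> x)" for x
    unfolding r jtriple_alt q2 p2 by (simp only: jprod_lin jordan_left_commute)
  have s: "?s \<odot> x = 2 *\<^sub>R (a \<odot> (?r \<odot> x)) - jtriple a (?q \<odot> x)" for x
  proof -
    have "(a \<odot> x) \<odot> (a \<odot> ?q) + (a \<odot> ?q) \<odot> (a \<odot> x) + (x \<odot> ?q) \<odot> (a \<odot> a)
       = ((a \<odot> x) \<odot> a) \<odot> ?q + ((a \<odot> ?q) \<odot> a) \<odot> x + ((x \<odot> ?q) \<odot> a) \<odot> a"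
      by (rule jordan_linearized)
    moreover have "(a \<odot> x) \<odot> (a \<odot> ?q) = a \<odot> (?r \<odot> x)"
      by (metis jprod_commute jpower.simps(2) r1)
    moreover have "(a \<odot> ?q) \<odot> (a \<odot> x) = a \<odot> (?r \<odot> x)"
      by (metis jpower.simps(2) r1)
    moreover have "(x \<odot> ?q) \<odot> (a \<odot> a) = (a \<odot> a) \<odot> (?q \<odot> x)" by (metis jprod_commute)
    moreover have "((a \<odot> x) \<odot> a) \<odot> ?q = a \<odot> (a \<odot> (?q \<odot> x))" by (metis jprod_commute q1)
    moreover have "((a \<odot> ?q) \<odot> a) \<odot> x = ?s \<odot> x" by (metis jprod_commute jpower.simps(2))
    moreover have "((x \<odot> ?q) \<odot> a) \<odot> a = a \<odot> (a \<odot> (?q \<odot> x))" by (metis jprod_commute)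
    ultimately show ?thesis
      by (simp add: jtriple_alt scaleR_2 del: jpower.simps) (simp add: algebra_simps del: jpower.simps)
  qed
  show ?case using r1 r2 q1 q2 s by blast
qed

lemma jpower_mult_rec:
  "jpower a (Suc (Suc n)) \<odot> x = 2 *\<^sub>R (a \<odot> (jpower a (Suc n) \<odot> x)) - jtriple a (jpower a n \<odot> x)"
  using jpower_commute_base by blast

lemma jpower_comm1: "jpower a n \<odot> (a \<odot> x) = a \<odot> (jpower a n \<odot> x)"
  and jpower_comm2: "jpower a n \<odot> ((a \<odot> a) \<odot> x) = (a \<odot> a) \<odot> (jpower a n \<odot> x)"
  using jpower_commute_base[of a n] by blast+

lemma jpower_triple_comm: "jpower a n \<odot> jtriple a x = jtriple a (jpower a n \<odot> x)"
  by (simp add: jtriple_alt jprod_lin jpower_comm1 jpower_comm2)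

lemma jtriple_base_comm: "jtriple a (a \<odot> x) = a \<odot> jtriple a x"
  by (simp add: jtriple_alt jprod_lin jordan_left_commute)

lemma jpower_left_commute:
  "jpower a m \<odot> (jpower a n \<odot> x) = jpower a n \<odot> (jpower a m \<odot> x)"
proof (induction n rule: induct_nat_012)
  case (ge2 n)
  then show ?case
    by (simp only: jpower_mult_rec jprod_lin jpower_comm1 jpower_triple_comm)
qed (simp_all add: jpower_comm1)

lemma jpower_add: "jpower a i \<odot> jpower a j = jpower a (i + j)"
proof (induction j arbitrary: i)
  case (Suc j)
  have "jpower a i \<odot> (a \<odot> jpower a j) = a \<odot> (jpower a i \<odot> jpower a j)" by (rule jpower_comm1)
  with Suc show ?case by simp
qed simp

text \<open>The identity \<open>U(a x, a y) = U(a) U(x, y)\<close> on powers of \<open>a\<close>. The difference of the two sides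
  satisfies in \<open>n\<close> the recurrence of \<open>L(a\<^sup>n)\<close>, and it vanishes for \<open>n = 0\<close> and \<open>n = 1\<close>.\<close>

lemma jtriple_shift_powers:
  fixes a x :: "'a::unital_jb_algebra"
  shows "jtri (jpower a (Suc m)) (jpower a (Suc n)) x = jtriple a (jtri (jpower a m) (jpower a n) x)"
proof -
  define F where "F n x = jpower a (Suc m) \<odot> (jpower a (Suc n) \<odot> x) - a \<odot> (jpower a (Suc (m + n)) \<odot> x)
     - jtriple a (jpower a m \<odot> (jpower a n \<odot> x)) + jtriple a (jpower a (m + n) \<odot> x)" for n x
  have "F n x = 0" for x
  proof (induction n arbitrary: x rule: induct_nat_012)
    case 0
    show ?case by (simp add: F_def) (metis jpower.simps(2) jpower_comm1)
  next
    case 1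
    have b: "jpower a (Suc 0) = a" by simp
    have c: "jpower a (Suc m) \<odot> ((a \<odot> a) \<odot> x) = (a \<odot> a) \<odot> (jpower a (Suc m) \<odot> x)"
      by (rule jpower_comm2)
    show ?case
      unfolding F_def add_0_right add_Suc_right jpower_mult_rec[of a m] jpower_mult_rec[of a 0] b
        jpower.simps(1) jprod_one_left jpower_comm1
      by (simp only: jprod_lin jtriple_lin jpower_comm1 jpower_triple_comm jtriple_base_comm)
         (simp only: jtriple_alt[of a "jpower a (Suc m) \<odot> x"] jtriple_alt[of a x] jprod_lin jpower_comm1 c, simp)
  next
    case (ge2 n)
    have "F (Suc (Suc n)) x = 2 *\<^sub>R (a \<odot> F (Suc n) x) - jtriple a (F n x)"
      unfolding F_def
      by (simp only: jpower_mult_rec add_Suc_right)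
        (simp only: jprod_lin jtriple_lin jpower_comm1 jpower_triple_comm jtriple_base_comm,
         simp add: jtriple_lin jtriple_base_comm algebra_simps del: jpower.simps)
    then show ?case by (simp add: ge2 jtriple_lin jprod_lin)
  qed
  then have "jpower a (Suc m) \<odot> (jpower a (Suc n) \<odot> x) = a \<odot> (jpower a (Suc (m + n)) \<odot> x)
     + jtriple a (jpower a m \<odot> (jpower a n \<odot> x)) - jtriple a (jpower a (m + n) \<odot> x)"
    unfolding F_def by (simp add: algebra_simps)
  then show ?thesis
    unfolding jtri_def jpower_add jpower_left_commute[of a "Suc n" "Suc m"] jpower_left_commute[of a n m]
    by (simp only: add_Suc add_Suc_right jpower_mult_rec jtriple_lin scaleR_2 [symmetric])
       (simp add: scaleR_2 jtriple_lin algebra_simps del: jpower.simps)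
qed

section \<open>The closed subalgebra generated by one element\<close>

definition jgen :: "'a::unital_jb_algebra \<Rightarrow> 'a set" where
  "jgen a = closure (span (range (jpower a)))"

lemma closed_jgen: "closed (jgen a)"
  by (simp add: jgen_def)

lemma span_subset_jgen: "span (range (jpower a)) \<subseteq> jgen a"
  by (simp add: jgen_def closure_subset)

lemma jpower_in_jgen: "jpower a n \<in> jgen a"
  using span_subset_jgen by (meson range_eqI span_base subsetD)

lemma subspace_closure:
  fixes S :: "'a::real_normed_vector set"
  assumes "subspace S" shows "subspace (closure S)"
proof -
  have S: "0 \<in> S" "\<And>x y. x \<in> S \<Longrightarrow> y \<in> S \<Longrightarrow> x + y \<in> S" "\<And>c x. x \<in> S \<Longrightarrow> c *\<^sub>R x \<in> S"
    using assms by (auto simp: subspace_def)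
  have "x + y \<in> closure S" if "x \<in> closure S" "y \<in> closure S" for x y
  proof -
    obtain f g where "\<forall>n. f n \<in> S" "f \<longlonglongrightarrow> x" "\<forall>n. g n \<in> S" "g \<longlonglongrightarrow> y"
      using \<open>x \<in> closure S\<close> \<open>y \<in> closure S\<close> unfolding closure_sequential by blast
    then show ?thesis
      unfolding closure_sequential using S(2) tendsto_add[of f x sequentially g y]
      by (intro exI[of _ "\<lambda>n. f n + g n"]) auto
  qed
  moreover have "c *\<^sub>R x \<in> closure S" if "x \<in> closure S" for x c
  proof -
    obtain f where "\<forall>n. f n \<in> S" "f \<longlonglongrightarrow> x"
      using \<open>x \<in> closure S\<close> unfolding closure_sequential by blast
    then show ?thesis
      unfolding closure_sequential using S(3)
      by (intro exI[of _ "\<lambda>n. c *\<^sub>R f n"]) (auto intro!: tendsto_intros)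
  qed
  ultimately show ?thesis
    using S(1) closure_subset[of S] by (auto simp: subspace_def)
qed

lemma subspace_jgen: "subspace (jgen a)"
  by (simp add: jgen_def subspace_closure)

lemma jgen_subset:
  assumes "closed S" "subspace S" "\<And>n. jpower a n \<in> S"
  shows "jgen a \<subseteq> S"
  unfolding jgen_def using assms by (intro closure_minimal span_minimal) auto

lemma jgen_add: "x \<in> jgen a \<Longrightarrow> y \<in> jgen a \<Longrightarrow> x + y \<in> jgen a"
  and jgen_diff: "x \<in> jgen a \<Longrightarrow> y \<in> jgen a \<Longrightarrow> x - y \<in> jgen a"
  and jgen_scaleR: "x \<in> jgen a \<Longrightarrow> r *\<^sub>R x \<in> jgen a"
  and jgen_minus: "x \<in> jgen a \<Longrightarrow> - x \<in> jgen a"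
  and jgen_0: "0 \<in> jgen a"
  using subspace_jgen[of a]
  by (simp_all add: subspace_add subspace_diff subspace_scale subspace_neg subspace_0)

lemma jgen_one: "1 \<in> jgen a"
  using jpower_in_jgen[of a 0] by simp

lemma jgen_self: "a \<in> jgen a"
  using jpower_in_jgen[of a "Suc 0"] by simp

lemma bounded_linear_eq_on_jgen:
  assumes "bounded_linear f" "bounded_linear g"
    and "\<And>n. f (jpower a n) = g (jpower a n)" and "x \<in> jgen a"
  shows "f x = g x"
proof -
  have "jgen a \<subseteq> {x. f x = g x}"
  proof (rule jgen_subset)
    show "closed {x. f x = g x}"
      by (rule closed_Collect_eq[OF linear_continuous_on[OF assms(1)] linear_continuous_on[OF assms(2)]])
    show "subspace {x. f x = g x}"
      using bounded_linear.linear[OF assms(1)] bounded_linear.linear[OF assms(2)]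
      by (auto simp: subspace_def linear_add linear_scale linear_0)
  qed (use assms in auto)
  then show ?thesis using assms(4) by auto
qed

lemmas bl_right = jprod.bounded_linear_right
lemmas bl_left = jprod.bounded_linear_left

text \<open>For \<open>b\<close> in the subalgebra this is its associativity, by commutativity of the product; arbitrary \<open>b\<close> is
  what makes \<open>jtriple x\<close> and \<open>jtriple y\<close> commute as operators.\<close>

lemma jgen_left_commute:
  assumes "x \<in> jgen a" "y \<in> jgen a"
  shows "x \<odot> (y \<odot> b) = y \<odot> (x \<odot> b)"
proof -
  have A: "x \<odot> (jpower a n \<odot> b) = jpower a n \<odot> (x \<odot> b)" if "x \<in> jgen a" for x n
    by (rule bounded_linear_eq_on_jgen[OF bl_left bounded_linear_compose[OF bl_right bl_left] _ that])
      (rule jpower_left_commute)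
  show ?thesis
    by (rule bounded_linear_eq_on_jgen[OF bounded_linear_compose[OF bl_right bl_left] bl_left _ assms(2)])
      (rule A[OF assms(1)])
qed

lemma jgen_mult:
  assumes "x \<in> jgen a" "y \<in> jgen a"
  shows "x \<odot> y \<in> jgen a"
proof -
  have sub: "closed {x. x \<odot> z \<in> jgen a}" "subspace {x. x \<odot> z \<in> jgen a}" for z
    using closed_vimage[OF closed_jgen[of a] linear_continuous_on[OF bl_left[of z]]]
    by (auto simp: vimage_def subspace_def jprod_lin jgen_add jgen_scaleR jgen_0)
  have "jgen a \<subseteq> {x. x \<odot> jpower a n \<in> jgen a}" for n
    by (intro jgen_subset sub) (simp add: jpower_add jpower_in_jgen)
  then have "jgen a \<subseteq> {y. y \<odot> x \<in> jgen a}"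
    using assms by (intro jgen_subset sub) (auto simp: jprod_commute[of "jpower a _" x])
  then show ?thesis using assms by (auto simp: jprod_commute[of x])
qed

lemma jgen_assoc:
  assumes "x \<in> jgen a" "z \<in> jgen a"
  shows "(x \<odot> y) \<odot> z = x \<odot> (y \<odot> z)"
  using jgen_left_commute[OF assms(2,1), of y] by (metis jprod_commute)

lemmas jgen_closed = jgen_add jgen_diff jgen_scaleR jgen_minus jgen_0 jgen_one jgen_self jgen_mult

lemma jgen_mono:
  assumes "b \<in> jgen a" shows "jgen b \<subseteq> jgen a"
proof (rule jgen_subset[OF closed_jgen subspace_jgen])
  show "jpower b n \<in> jgen a" for n
    by (induction n) (auto intro: jgen_closed assms)
qed

lemma jtriple_jgen:
  assumes "x \<in> jgen a" "y \<in> jgen a"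
  shows "jtriple x y = (x \<odot> x) \<odot> y"
  using assms by (simp add: jtriple_alt jgen_assoc scaleR_2)

lemma jtriple_comm_jgen:
  assumes "x \<in> jgen a" "y \<in> jgen a"
  shows "jtriple x (jtriple y b) = jtriple y (jtriple x b)"
proof -
  have m: "x \<odot> x \<in> jgen a" "y \<odot> y \<in> jgen a" using assms by (auto intro: jgen_mult)
  note c = jgen_left_commute[OF assms] jgen_left_commute[OF assms(1) m(2)]
    jgen_left_commute[OF m(1) assms(2)] jgen_left_commute[OF m]
  show ?thesis
    by (simp only: jtriple_alt jprod_lin c scaleR_diff_right) (simp add: algebra_simps)
qed

text \<open>The multiplicativity of \<open>U\<close> inside one generated subalgebra. It takes the place of the
  fundamental formula \<open>U(U(a) b) = U(a) U(b) U(a)\<close>.\<close>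

lemma jtriple_mult_jgen:
  assumes x: "x \<in> jgen a"
  shows "jtriple (a \<odot> x) b = jtriple a (jtriple x b)"
proof -
  have sym: "jtri u v b = jtri v u b" for u v by (simp add: jtri_def jprod_commute)
  have L0: "bounded_linear (\<lambda>x. jtri x y b)" for y
    unfolding jtri_def
    by (rule bounded_linear_sub[OF bounded_linear_add[OF bl_left bounded_linear_compose[OF bl_right bl_left]]
          bounded_linear_compose[OF bl_left bl_left]])
  have L: "bounded_linear (\<lambda>x. jtri (a \<odot> x) (a \<odot> y) b)" "bounded_linear (\<lambda>x. jtriple a (jtri x y b))" for y
    using bounded_linear_compose[OF L0[of "a \<odot> y"] bl_right[of a]]
      bounded_linear_compose[OF bounded_linear_jtriple[of a] L0[of y]] by simp_all
  have L': "bounded_linear (\<lambda>x. jtri (a \<odot> y) (a \<odot> x) b)" "bounded_linear (\<lambda>x. jtriple a (jtri y x b))" for y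
    using L[of y] by (simp_all add: sym[of "a \<odot> y"] sym[of y])
  have "jtri (a \<odot> x) (a \<odot> jpower a n) b = jtriple a (jtri x (jpower a n) b)" if "x \<in> jgen a" for x n
    by (rule bounded_linear_eq_on_jgen[OF L _ that])
      (use jtriple_shift_powers[of a _ n b] in simp)
  then have "jtri (a \<odot> x) (a \<odot> x) b = jtriple a (jtri x x b)"
    by (rule bounded_linear_eq_on_jgen[OF L' _ x]) (rule x)
  then show ?thesis by (simp add: jtri_same)
qed

lemma norm_jtriple_le: "norm (jtriple x b) \<le> 3 * norm x ^ 2 * norm b"
proof -
  have "norm (jtriple x b) \<le> norm (2 *\<^sub>R (x \<odot> (x \<odot> b))) + norm ((x \<odot> x) \<odot> b)"
    unfolding jtriple_alt by (rule norm_triangle_ineq4)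
  moreover have "norm (x \<odot> (x \<odot> b)) \<le> norm x * (norm x * norm b)"
    by (meson norm_jprod_le mult_left_mono norm_ge_zero order_trans)
  moreover have "norm ((x \<odot> x) \<odot> b) \<le> norm x ^ 2 * norm b"
    by (metis norm_jprod_le norm_jsquare)
  ultimately show ?thesis by (simp add: power2_eq_square algebra_simps)
qed

section \<open>Neumann series and square roots\<close>

lemma complete_jgen_cball: "complete (jgen a \<inter> cball 0 r)"
  by (simp add: complete_eq_closed closed_jgen closed_Int)

text \<open>The inverse of \<open>1 - v\<close> is the fixed point of the contraction \<open>z \<mapsto> 1 + v z\<close>.\<close>

lemma jgen_neumann:
  assumes v: "v \<in> jgen a" "norm v < 1"
  obtains z where "z \<in> jgen a" "(1 - v) \<odot> z = 1"
proof -
  have "\<exists>!z\<in>jgen a. 1 + v \<odot> z = z"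
  proof (rule Banach_fix)
    show "complete (jgen a)" by (simp add: complete_eq_closed closed_jgen)
    show "(\<lambda>z. 1 + v \<odot> z) ` jgen a \<subseteq> jgen a" using v by (auto intro!: jgen_closed)
    show "dist (1 + v \<odot> x) (1 + v \<odot> y) \<le> norm v * dist x y" for x y
      using norm_jprod_le[of v "x - y"] by (simp add: dist_norm jprod_lin)
  qed (use v jgen_one in auto)
  then obtain z where "z \<in> jgen a" "1 + v \<odot> z = z" by blast
  then show ?thesis by (intro that[of z]) (auto simp: jprod_lin algebra_simps)
qed

text \<open>The square root of \<open>1 - y\<close> is \<open>1 - z\<close> for the fixed point \<open>z\<close> of \<open>z \<mapsto> (y + z\<^sup>2) / 2\<close>. The radius \<open>r\<close>
  is the fixed point of the scalar iteration with \<open>\<parallel>y\<parallel>\<close> in place of \<open>y\<close>; on the ball of radius \<open>r\<close> the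
  map is a contraction with constant \<open>r\<close>, because \<open>u\<^sup>2 - v\<^sup>2 = (u + v) (u - v)\<close> by commutativity.\<close>

lemma jgen_sqrt:
  assumes y: "y \<in> jgen a" "norm y < 1"
  obtains w where "w \<in> jgen a" "w \<odot> w = 1 - y"
proof -
  define r where "r = 1 - sqrt (1 - norm y)"
  have r: "0 \<le> r" "r < 1" using y by (auto simp: r_def)
  have "(1 - r)\<^sup>2 = 1 - norm y" using y by (simp add: r_def)
  then have ry: "norm y + r\<^sup>2 = 2 * r" by (simp add: power2_eq_square algebra_simps)
  have "\<exists>!z\<in>jgen a \<inter> cball 0 r. (1/2) *\<^sub>R (y + z \<odot> z) = z"
  proof (rule Banach_fix)
    show "complete (jgen a \<inter> cball 0 r)" by (rule complete_jgen_cball)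
    show "jgen a \<inter> cball 0 r \<noteq> {}" using r jgen_0[of a] by (metis IntI centre_in_cball empty_iff)
    show "(\<lambda>z. (1/2) *\<^sub>R (y + z \<odot> z)) ` (jgen a \<inter> cball 0 r) \<subseteq> jgen a \<inter> cball 0 r"
    proof (rule image_subsetI)
      fix z assume "z \<in> jgen a \<inter> cball 0 r"
      then have z: "z \<in> jgen a" "norm z \<le> r" by auto
      have "(1/2) *\<^sub>R (y + z \<odot> z) \<in> jgen a" using y z by (intro jgen_closed)
      have "norm (y + z \<odot> z) \<le> norm y + norm z ^ 2" by (metis norm_triangle_ineq norm_jsquare)
      also have "\<dots> \<le> norm y + r\<^sup>2" using z by (intro add_left_mono power_mono) auto
      also have "\<dots> = 2 * r" by (rule ry)
      finally have "norm (y + z \<odot> z) \<le> 2 * r" .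
      with \<open>(1/2) *\<^sub>R (y + z \<odot> z) \<in> jgen a\<close>
      show "(1/2) *\<^sub>R (y + z \<odot> z) \<in> jgen a \<inter> cball 0 r" by simp
    qed
    show "dist ((1/2) *\<^sub>R (y + u \<odot> u)) ((1/2) *\<^sub>R (y + v \<odot> v)) \<le> r * dist u v"
      if "u \<in> jgen a \<inter> cball 0 r" "v \<in> jgen a \<inter> cball 0 r" for u v
    proof -
      have "(1/2) *\<^sub>R (y + u \<odot> u) - (1/2) *\<^sub>R (y + v \<odot> v) = (1/2) *\<^sub>R ((u + v) \<odot> (u - v))"
        by (simp add: jprod_lin jprod_commute[of v u] algebra_simps)
      moreover have "norm ((u + v) \<odot> (u - v)) \<le> (2 * r) * norm (u - v)"
        using that by (intro order_trans[OF norm_jprod_le] mult_right_mono)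
          (auto intro: order_trans[OF norm_triangle_ineq])
      ultimately show ?thesis by (simp add: dist_norm)
    qed
  qed (use r in auto)
  then obtain z where z: "z \<in> jgen a" "(1/2) *\<^sub>R (y + z \<odot> z) = z" by blast
  have "y + z \<odot> z = 2 *\<^sub>R ((1/2) *\<^sub>R (y + z \<odot> z))" by simp
  also have "\<dots> = 2 *\<^sub>R z" by (simp only: z(2))
  finally have "y + z \<odot> z = 2 *\<^sub>R z" .
  then have "(1 - z) \<odot> (1 - z) = 1 - y"
    by (simp add: jprod_lin scaleR_2 algebra_simps)
  with z show ?thesis by (intro that[of "1 - z"]) (auto intro: jgen_closed)
qed

section \<open>Jordan inverses lie in the generated subalgebra\<close>

declare jprod.zero_left [simp] jprod.zero_right [simp]

lemma norm_one_le: "norm (1::'a::unital_jb_algebra) \<le> 1"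
proof -
  have "norm (1::'a) = norm (1::'a) ^ 2" using norm_jsquare[of "1::'a"] by simp
  then show ?thesis by (auto simp: power2_eq_square)
qed

lemma norm_scaleR_one_le: "norm (r *\<^sub>R (1::'a::unital_jb_algebra)) \<le> \<bar>r\<bar>"
  using mult_left_le[OF norm_one_le, of "\<bar>r\<bar>"] by simp

lemma jgen_mult_square:
  assumes "x \<in> jgen a" "y \<in> jgen a"
  shows "(x \<odot> y) \<odot> (x \<odot> y) = (x \<odot> x) \<odot> (y \<odot> y)"
  using assms by (simp add: jgen_assoc jgen_mult jgen_left_commute[of y a x])

text \<open>This is the reality of the spectrum. If \<open>k = v\<^sup>2 + \<beta>\<^sup>2\<close> is scaled into the unit ball by \<open>K\<close>, then
  \<open>1 - k / K\<close> is a square \<open>s\<^sup>2\<close>, and \<open>\<parallel>s\<^sup>2\<parallel> \<le> \<parallel>s\<^sup>2 + v\<^sup>2 / K\<parallel> = 1 - \<beta>\<^sup>2 / K < 1\<close>; so \<open>k / K = 1 - s\<^sup>2\<close> has an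
  inverse.\<close>

lemma jgen_square_plus_invertible:
  assumes v: "v \<in> jgen a" and "\<beta> \<noteq> 0"
  obtains z where "z \<in> jgen a" "(v \<odot> v + \<beta>\<^sup>2 *\<^sub>R 1) \<odot> z = 1"
proof -
  let ?k = "v \<odot> v + \<beta>\<^sup>2 *\<^sub>R 1"
  define K where "K = norm ?k + \<beta>\<^sup>2 + 1"
  have K: "K > 0" "norm ?k < K" "0 < \<beta>\<^sup>2" "\<beta>\<^sup>2 < K"
    using \<open>\<beta> \<noteq> 0\<close> norm_ge_zero[of ?k] by (auto simp: K_def add_nonneg_pos add_pos_pos) 
  have k: "?k \<in> jgen a" using v by (intro jgen_closed)
  have "norm ((1/K) *\<^sub>R ?k) = norm ?k / K" using K(1) by simp
  also have "\<dots> < 1" using K(1,2) by (simp only: pos_divide_less_eq mult_1)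
  finally have "norm ((1/K) *\<^sub>R ?k) < 1" .
  then obtain s where s: "s \<in> jgen a" "s \<odot> s = 1 - (1/K) *\<^sub>R ?k"
    using jgen_sqrt[of "(1/K) *\<^sub>R ?k" a] k by (blast intro: jgen_scaleR)
  let ?v = "(1 / sqrt K) *\<^sub>R v"
  have vv: "?v \<odot> ?v = (1/K) *\<^sub>R (v \<odot> v)" using K(1) by (simp add: jprod_lin)
  have "norm (s \<odot> s) \<le> norm (s \<odot> s + ?v \<odot> ?v)" by (rule norm_jsquare_le)
  also have "s \<odot> s + ?v \<odot> ?v = (1 - \<beta>\<^sup>2 / K) *\<^sub>R 1"
    unfolding vv s by (simp add: algebra_simps)
  also have "norm \<dots> \<le> \<bar>1 - \<beta>\<^sup>2 / K\<bar>" by (rule norm_scaleR_one_le)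
  also have "\<dots> < 1"
  proof -
    have "0 < \<beta>\<^sup>2 / K" "\<beta>\<^sup>2 / K < 1"
      using K(4) by (simp_all only: divide_pos_pos[OF K(3,1)] pos_divide_less_eq[OF K(1)] mult_1)
    then show ?thesis by linarith
  qed
  finally have "norm (s \<odot> s) < 1" .
  then obtain z where z: "z \<in> jgen a" "(1 - s \<odot> s) \<odot> z = 1"
    using jgen_neumann[of "s \<odot> s" a] s by (blast intro: jgen_mult)
  then have "?k \<odot> ((1/K) *\<^sub>R z) = 1" unfolding s by (simp add: jprod_lin)
  with z show ?thesis by (intro that[of "(1/K) *\<^sub>R z"] jgen_scaleR)
qed

text \<open>The norm of a square belongs to its spectrum. For \<open>R > \<parallel>y\<parallel>\<close> the element \<open>R - y\<close> is an invertible
  square, and its inverse \<open>t\<close> satisfies \<open>\<parallel>t\<parallel> \<ge> 1 / (R - \<parallel>y\<parallel>)\<close>: whenever \<open>e \<parallel>t\<parallel> < 1\<close>, the element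
  \<open>R - y - e = (R - y) (1 - e t)\<close> is again a square \<open>q\<^sup>2\<close>, so that \<open>\<parallel>y\<parallel> \<le> \<parallel>y + q\<^sup>2\<parallel> \<le> R - e\<close>. If
  \<open>\<parallel>y\<parallel> - y\<close> had an inverse, the inverses \<open>t\<close> would stay bounded as \<open>R\<close> decreases to \<open>\<parallel>y\<parallel>\<close>.\<close>

lemma norm_square_minus_not_invertible:
  assumes x: "x \<in> jgen a" and z: "z \<in> jgen a"
    and ne: "(1::'a::unital_jb_algebra) \<noteq> 0"
  shows "(norm (x \<odot> x) *\<^sub>R 1 - x \<odot> x) \<odot> z \<noteq> (1::'a)"
proof
  let ?y = "x \<odot> x" and ?N = "norm (x \<odot> x)"
  assume inv: "(?N *\<^sub>R 1 - ?y) \<odot> z = 1"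
  have N: "?N > 0" using inv ne by (cases "?y = 0") (auto simp: jprod_lin)
  have z0: "norm z > 0" using inv ne by (auto simp: jprod_lin)
  \<comment> \<open>The distance \<open>d\<close> of \<open>R\<close> from the norm gives \<open>\<parallel>t\<parallel> \<le> 3/2 \<parallel>z\<parallel>\<close>, so \<open>e\<close> may exceed \<open>d\<close>; the bound
    \<open>e \<le> R\<close> keeps the scalar \<open>R - e\<close> nonnegative.\<close>
  define d where "d = 1 / (3 * norm z)"
  define R where "R = ?N + d"
  define e where "e = min (1 / (2 * norm z)) R"
  have d: "d > 0" using z0 by (simp add: d_def)
  have R: "R > 0" "?N < R" unfolding R_def using N d by linarith+
  have e: "d < e" "e \<le> R" "e \<le> 1 / (2 * norm z)" using z0 N by (auto simp: e_def R_def d_def field_simps)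
  have yR: "(1/R) *\<^sub>R ?y \<in> jgen a" "norm ((1/R) *\<^sub>R ?y) < 1" using x R by (auto intro!: jgen_closed)
  obtain w where w: "w \<in> jgen a" "w \<odot> w = 1 - (1/R) *\<^sub>R ?y" using jgen_sqrt[OF yR] .
  obtain z' where z': "z' \<in> jgen a" "(1 - (1/R) *\<^sub>R ?y) \<odot> z' = 1" using jgen_neumann[OF yR] .
  define u where "u = R *\<^sub>R 1 - ?y"
  define t where "t = (1/R) *\<^sub>R z'"
  have u: "u \<in> jgen a" and t: "t \<in> jgen a" unfolding u_def t_def using x z' by (auto intro!: jgen_closed)
  have uw: "u = R *\<^sub>R (w \<odot> w)" unfolding w u_def using R by (simp add: algebra_simps)
  have ut: "u \<odot> t = 1" using z' R unfolding uw t_def w by (simp add: jprod_lin)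
  have "t = t \<odot> ((?N *\<^sub>R 1 - ?y) \<odot> z)" by (simp add: inv)
  also have "?N *\<^sub>R 1 - ?y = u - d *\<^sub>R 1" by (simp add: u_def R_def algebra_simps)
  also have "t \<odot> ((u - d *\<^sub>R 1) \<odot> z) = z - d *\<^sub>R (t \<odot> z)"
    using ut jgen_assoc[OF t z, of u] by (simp add: jprod_lin jprod_commute[of t u])
  finally have "norm t = norm (z - d *\<^sub>R (t \<odot> z))" by (rule arg_cong)
  also have "\<dots> \<le> norm z + norm (d *\<^sub>R (t \<odot> z))" by (rule norm_triangle_ineq4)
  also have "norm (d *\<^sub>R (t \<odot> z)) \<le> d * (norm t * norm z)"
    using d norm_jprod_le[of t z] by simp
  also have "\<dots> = norm t / 3" using z0 by (simp add: d_def)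
  finally have tz: "norm t \<le> 3/2 * norm z" by simp
  have "norm (e *\<^sub>R t) \<le> e * (3/2 * norm z)" using e d tz by (simp add: mult_left_mono)
  also have "\<dots> \<le> (1 / (2 * norm z)) * (3/2 * norm z)" using e by (intro mult_right_mono) auto
  also have "\<dots> < 1" using z0 by simp
  finally have et: "norm (e *\<^sub>R t) < 1" .
  obtain s where s: "s \<in> jgen a" "s \<odot> s = 1 - e *\<^sub>R t"
    using jgen_sqrt[OF jgen_scaleR[OF t] et] .
  define q where "q = sqrt R *\<^sub>R (w \<odot> s)"
  have "q \<odot> q = R *\<^sub>R ((w \<odot> w) \<odot> (s \<odot> s))"
    using R(1) jgen_mult_square[OF w(1) s(1)] by (simp add: q_def jprod_lin)
  also have "\<dots> = u \<odot> (1 - e *\<^sub>R t)" by (simp add: uw s jprod_lin scaleR_diff_right mult.commute)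
  also have "\<dots> = u - e *\<^sub>R 1" by (simp add: jprod_lin ut)
  finally have "?y + q \<odot> q = (R - e) *\<^sub>R 1" by (simp add: u_def algebra_simps)
  then have "?N \<le> norm ((R - e) *\<^sub>R (1::'a))" by (metis norm_jsquare_le)
  also have "\<dots> \<le> R - e" using norm_scaleR_one_le[of "R - e"] e by simp
  finally show False using e by (simp add: R_def)
qed

text \<open>Two instances of the linearized identity give \<open>A\<^sup>2 \<odot> B\<^sup>2 = 1\<close> and \<open>A \<odot> (A \<odot> B\<^sup>2) = 1\<close>.\<close>

lemma jinverse_triple_square:
  assumes "is_jinverse A B"
  shows "jtriple A (B \<odot> B) = 1"
proof -
  have i: "A \<odot> B = 1" "B \<odot> A = 1" "(A \<odot> A) \<odot> B = A"
    using assms by (auto simp: is_jinverse_def jprod_commute)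
  have 1: "(A \<odot> B) \<odot> (B \<odot> A) + (A \<odot> A) \<odot> (B \<odot> B) + (B \<odot> A) \<odot> (B \<odot> A)
      = ((A \<odot> B) \<odot> B) \<odot> A + ((A \<odot> A) \<odot> B) \<odot> B + ((B \<odot> A) \<odot> B) \<odot> A"
    by (rule jordan_linearized)
  then have sq: "(A \<odot> A) \<odot> (B \<odot> B) = 1" by (simp add: i)
  have "(A \<odot> B) \<odot> (A \<odot> B) + (A \<odot> B) \<odot> (A \<odot> B) + (B \<odot> B) \<odot> (A \<odot> A)
      = ((A \<odot> B) \<odot> A) \<odot> B + ((A \<odot> B) \<odot> A) \<odot> B + ((B \<odot> B) \<odot> A) \<odot> A"
    by (rule jordan_linearized)
  then have "A \<odot> (A \<odot> (B \<odot> B)) = 1"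
    using sq by (simp add: i jprod_commute[of "B \<odot> B" "A \<odot> A"] jprod_commute[of "B \<odot> B" A]
        jprod_commute[of "A \<odot> (B \<odot> B)" A])
  then show ?thesis by (simp add: jtriple_alt sq scaleR_2)
qed

lemma jtriple_one [simp]: "jtriple 1 b = b" "jtriple b 1 = b \<odot> b"
  by (simp_all add: jtriple_def scaleR_2)

text \<open>From \<open>U(a) B\<^sup>2 = 1\<close> one gets \<open>g\<^sup>2 = U(g) U(a) B\<^sup>2 = U(a g) B\<^sup>2\<close>, hence \<open>\<parallel>g\<parallel>\<^sup>2 \<le> 3 \<parallel>a g\<parallel>\<^sup>2 \<parallel>B\<^sup>2\<parallel>\<close> for all
  \<open>g\<close> in the generated subalgebra. The element \<open>g = e\<^sup>2 (a\<^sup>2 + e\<^sup>2)\<^sup>-\<^sup>1\<close> has \<open>\<parallel>a g\<parallel> = O(e \<parallel>g\<parallel>)\<close>. For small \<open>e\<close>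
  this forces \<open>\<parallel>g\<parallel> < 1\<close>, and then \<open>1 - g\<close>, a multiple of \<open>a\<close>, is invertible.\<close>

lemma jinverse_imp_jgen_inverse:
  assumes B: "is_jinverse a B"
  obtains z where "z \<in> jgen a" "a \<odot> z = 1"
proof -
  define b where "b = norm (B \<odot> B)"
  have b: "b \<ge> 0" by (simp add: b_def)
  \<comment> \<open>Chosen so that \<open>6 b e\<^sup>2 < 1\<close>.\<close>
  define e where "e = 1 / sqrt (6 * b + 1)"
  have e: "e \<noteq> 0" "e\<^sup>2 = 1 / (6 * b + 1)" using b by (auto simp: e_def power_divide)
  obtain z where z: "z \<in> jgen a" "(a \<odot> a + e\<^sup>2 *\<^sub>R 1) \<odot> z = 1"
    using jgen_square_plus_invertible[OF jgen_self e(1)] .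
  define g where "g = e\<^sup>2 *\<^sub>R z"
  have g: "g \<in> jgen a" using z by (auto simp: g_def intro: jgen_scaleR)
  have g1: "1 - g = (a \<odot> a) \<odot> z" using z(2) by (simp add: g_def jprod_lin algebra_simps)
  have aag: "(a \<odot> a) \<odot> g = e\<^sup>2 *\<^sub>R (1 - g)" by (simp add: g1) (simp add: g_def jprod_lin)
  show ?thesis
  proof (cases "norm g < 1")
    case True
    obtain t where t: "t \<in> jgen a" "(1 - g) \<odot> t = 1" using jgen_neumann[OF g True] .
    have "a \<odot> (a \<odot> (z \<odot> t)) = 1"
      using t(2) jgen_assoc[OF jgen_self t(1), of "a \<odot> z"] jgen_assoc[OF jgen_self z(1), of a]
        jgen_assoc[OF jgen_self t(1), of z] unfolding g1 by simp
    then show ?thesis using t z by (intro that[of "a \<odot> (z \<odot> t)"]) (auto intro!: jgen_closed)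
  next
    case False
    have "g \<odot> g = jtriple g (jtriple a (B \<odot> B))"
      by (simp add: jinverse_triple_square[OF B])
    also have "\<dots> = jtriple (a \<odot> g) (B \<odot> B)"
      using g by (simp add: jtriple_comm_jgen[OF g jgen_self] jtriple_mult_jgen)
    finally have "norm g ^ 2 \<le> 3 * norm (a \<odot> g) ^ 2 * b"
      by (metis norm_jsquare norm_jtriple_le b_def)
    moreover have "norm (a \<odot> g) ^ 2 \<le> e\<^sup>2 * (2 * norm g ^ 2)"
    proof -
      have "norm (a \<odot> g) ^ 2 = norm ((a \<odot> g) \<odot> (a \<odot> g))" by (rule norm_jsquare [symmetric])
      also have "\<dots> = norm (((a \<odot> a) \<odot> g) \<odot> g)"
        by (simp only: jgen_mult_square[OF jgen_self g] jgen_assoc[OF jgen_mult[OF jgen_self jgen_self] g])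
      also have "\<dots> = e\<^sup>2 * norm ((1 - g) \<odot> g)" by (simp add: aag jprod_lin)
      also have "\<dots> \<le> e\<^sup>2 * ((2 * norm g) * norm g)"
        using False norm_triangle_ineq4[of 1 g] norm_one_le[where 'a='a]
        by (intro mult_left_mono order_trans[OF norm_jprod_le] mult_right_mono) (linarith | simp)+
      finally show ?thesis by (simp add: power2_eq_square mult.assoc)
    qed
    ultimately have "norm g ^ 2 \<le> 3 * (e\<^sup>2 * (2 * norm g ^ 2)) * b"
      using b by (smt (verit) mult_left_mono mult_right_mono)
    then have "norm g ^ 2 * (1 - 6 * b * e\<^sup>2) \<le> 0" by (simp add: algebra_simps)
    moreover have "1 - 6 * b * e\<^sup>2 > 0" using b unfolding e by (simp add: field_simps)
    moreover have "norm g ^ 2 > 0" using False by (intro zero_less_power) linarith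
    ultimately show ?thesis by (simp add: mult_le_0_iff)
  qed
qed

text \<open>A Jordan inverse \<open>B\<close> satisfies \<open>U(a) B = a\<close>, and \<open>U(z)\<close> inverts \<open>U(a)\<close>; so \<open>B = U(z) a\<close>.\<close>

lemma jinv_unique:
  assumes z: "z \<in> jgen a" "a \<odot> z = 1"
  shows "is_jinverse a B \<longleftrightarrow> B = z"
proof -
  have iz: "is_jinverse a z"
    using z jgen_assoc[OF jgen_self z(1), of a] by (simp add: is_jinverse_def)
  have "B = z" if "is_jinverse a B" for B
  proof -
    have "jtriple a C = a" if "is_jinverse a C" for C
      using that by (simp add: jtriple_def is_jinverse_def scaleR_2)
    moreover have "jtriple z (jtriple a C) = C" for C
      using z by (simp add: jtriple_comm_jgen[OF z(1) jgen_self] flip: jtriple_mult_jgen)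
    ultimately show ?thesis using iz that by metis
  qed
  with iz show ?thesis by blast
qed

lemma jgen_inverse:
  assumes x: "x \<in> jgen a" and z: "z \<in> jgen a" "x \<odot> z = 1"
  shows "jinvertible x" "jinv x = z" "is_jinverse x z"
proof -
  show 1: "is_jinverse x z" using x z by (simp add: is_jinverse_def jgen_assoc)
  then show "jinvertible x" by (auto simp: jinvertible_def)
  obtain z' where "z' \<in> jgen x" "x \<odot> z' = 1" using jinverse_imp_jgen_inverse[OF 1] .
  from jinv_unique[OF this] 1 show "jinv x = z" by (simp add: jinv_def)
qed

text \<open>Invertibility in the whole algebra and in the generated subalgebra coincide. This lets the
  spectrum, which is defined by the former, be computed in a commutative associative algebra.\<close>

lemma jinvertible_iff_jgen:
  assumes x: "x \<in> jgen a"
  shows "jinvertible x \<longleftrightarrow> (\<exists>z\<in>jgen a. x \<odot> z = 1)"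
  using jgen_inverse[OF x] jgen_mono[OF x] by (metis jinvertible_def jinverse_imp_jgen_inverse subsetD)

lemma jinvertible_mult:
  assumes "x \<in> jgen a" "y \<in> jgen a"
  shows "jinvertible (x \<odot> y) \<longleftrightarrow> jinvertible x \<and> jinvertible y"
proof
  assume "jinvertible (x \<odot> y)"
  then obtain z where z: "z \<in> jgen a" "(x \<odot> y) \<odot> z = 1"
    using assms by (metis jinvertible_iff_jgen jgen_mult)
  have "x \<odot> (y \<odot> z) = 1" "y \<odot> (x \<odot> z) = 1"
    using assms z by (metis jgen_assoc, metis jgen_assoc jgen_left_commute)
  then show "jinvertible x \<and> jinvertible y"
    using assms z by (meson jinvertible_iff_jgen jgen_mult)
next
  assume "jinvertible x \<and> jinvertible y"
  then obtain u v where uv: "u \<in> jgen a" "x \<odot> u = 1" "v \<in> jgen a" "y \<odot> v = 1"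
    using assms by (metis jinvertible_iff_jgen)
  have "(x \<odot> y) \<odot> (u \<odot> v) = x \<odot> (u \<odot> (y \<odot> v))"
    using assms uv by (simp add: jgen_assoc jgen_mult jgen_left_commute[of y a u])
  then have "(x \<odot> y) \<odot> (u \<odot> v) = 1" using uv by simp
  then show "jinvertible (x \<odot> y)" using assms uv by (meson jinvertible_iff_jgen jgen_mult)
qed

section \<open>Polynomials\<close>

lemma jpoly_altdef: "degree p \<le> n \<Longrightarrow> jpoly p a = (\<Sum>i\<le>n. coeff p i *\<^sub>R jpower a i)"
  unfolding jpoly_def by (intro sum.mono_neutral_left) (auto simp: coeff_eq_0)

lemma jpoly_0 [simp]: "jpoly 0 a = 0" by (simp add: jpoly_def)

lemma jpoly_pCons [simp]: "jpoly (pCons c p) a = c *\<^sub>R 1 + a \<odot> jpoly p a"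
proof -
  have "jpoly (pCons c p) a = (\<Sum>i\<le>Suc (degree p). coeff (pCons c p) i *\<^sub>R jpower a i)"
    by (intro jpoly_altdef degree_pCons_le)
  also have "\<dots> = c *\<^sub>R 1 + (\<Sum>i\<le>degree p. coeff p i *\<^sub>R (a \<odot> jpower a i))"
    by (simp add: sum.atMost_Suc_shift del: sum.atMost_Suc)
  also have "(\<Sum>i\<le>degree p. coeff p i *\<^sub>R (a \<odot> jpower a i)) = a \<odot> jpoly p a"
    by (simp add: jpoly_def jprod.sum_right jprod_lin)
  finally show ?thesis .
qed

lemma jpoly_add: "jpoly (p + q) a = jpoly p a + jpoly q a"
  by (induction p q rule: poly_induct2) (auto simp: jprod_lin algebra_simps)

lemma jpoly_smult: "jpoly (smult c p) a = c *\<^sub>R jpoly p a"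
  by (induction p) (auto simp: jprod_lin algebra_simps)

lemma jpoly_diff: "jpoly (p - q) a = jpoly p a - jpoly q a"
  using jpoly_add[of p "smult (-1) q" a] by (simp only: jpoly_smult) simp

lemma jpoly_in_jgen: "b \<in> jgen a \<Longrightarrow> jpoly p b \<in> jgen a"
  by (induction p) (auto intro!: jgen_closed)

lemma jpoly_mult: "jpoly (p * q) a = jpoly p a \<odot> jpoly q a"
proof (induction p)
  case (pCons c p)
  then show ?case
    using jgen_assoc[OF jgen_self jpoly_in_jgen[OF jgen_self], of a "jpoly p a" q]
    by (simp add: jpoly_add jpoly_smult jprod_lin)
qed simp

section \<open>The norm of a polynomial in one element\<close>

text \<open>A complex root \<open>z\<close> gives a real linear factor or the factor \<open>(X - Re z)\<^sup>2 + (Im z)\<^sup>2\<close>. The quadratic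
  is kept as a sum of two squares, since those are invertible in a JB-algebra.\<close>

lemma real_poly_factor:
  fixes q :: "real poly"
  assumes "degree q > 0"
  obtains (linear) c r where "q = [:- c, 1:] * r"
  | (quadratic) c b r where "b \<noteq> 0" "q = ([:- c, 1:] * [:- c, 1:] + [:b\<^sup>2:]) * r"
proof -
  \<comment> \<open>Evaluation of a real polynomial at a complex number.\<close>
  define ev where "ev p z = poly (map_poly complex_of_real p) z" for p z
  have ev_0: "ev 0 z = 0" for z by (simp add: ev_def)
  have ev_pCons: "ev (pCons c p) z = of_real c + z * ev p z" for c p z
    by (simp add: ev_def map_poly_pCons)
  have ev_add: "ev (p + p') z = ev p z + ev p' z" for p p' z
    by (induction p p' rule: poly_induct2) (simp_all add: ev_0 ev_pCons algebra_simps)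
  have ev_smult: "ev (smult c p) z = of_real c * ev p z" for c p z
    by (induction p) (simp_all add: ev_0 ev_pCons algebra_simps)
  have ev_mult: "ev (p * p') z = ev p z * ev p' z" for p p' z
    by (induction p) (simp_all add: ev_0 ev_pCons ev_add ev_smult algebra_simps)
  have ev_real: "ev p (of_real x) = of_real (poly p x)" for p x
    by (induction p) (simp_all add: ev_0 ev_pCons)
  have "\<not> constant (poly (map_poly complex_of_real q))"
    using assms by (simp add: constant_degree degree_map_poly)
  then obtain z where z: "ev q z = 0"
    unfolding ev_def using fundamental_theorem_of_algebra by blast
  show thesis
  proof (cases "Im z = 0")
    case True
    then have "z = of_real (Re z)" by (simp add: complex_eq_iff)
    with z ev_real[of q "Re z"] have "poly q (Re z) = 0" by (metis of_real_eq_0_iff)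
    then show thesis using linear by (auto simp: poly_eq_0_iff_dvd elim: dvdE)
  next
    case False
    define Q where "Q = [:- Re z, 1:] * [:- Re z, 1:] + [:(Im z)\<^sup>2:]"
    have Q: "Q = [:(Re z)\<^sup>2 + (Im z)\<^sup>2, - 2 * Re z, 1:]" by (simp add: Q_def power2_eq_square)
    have "ev Q z = 0"
      unfolding Q ev_pCons ev_0 by (simp add: complex_eq_iff power2_eq_square algebra_simps)
    then have "ev (q mod Q) z = 0"
      using z ev_add[of "q div Q * Q" "q mod Q" z] by (simp add: ev_mult)
    moreover obtain c0 c1 where c: "q mod Q = [:c0, c1:]"
    proof
      have "degree (q mod Q) < 2 \<or> q mod Q = 0"
        using degree_mod_less[of Q q] by (auto simp: Q)
      then have "coeff (q mod Q) (Suc (Suc n)) = 0" for n by (auto intro: coeff_eq_0)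
      then show "q mod Q = [:coeff (q mod Q) 0, coeff (q mod Q) 1:]"
        by (intro poly_eqI) (auto simp: coeff_pCons split: nat.split)
    qed
    ultimately have "of_real c0 + z * of_real c1 = 0" by (simp add: ev_pCons ev_0)
    then have "c1 * Im z = 0" "c0 + c1 * Re z = 0" by (auto simp: complex_eq_iff algebra_simps)
    then have "q mod Q = 0" using False c by simp
    then have "q = Q * (q div Q)" by (metis add.right_neutral mult_div_mod_eq)
    then show thesis using quadratic False unfolding Q_def by blast
  qed
qed

lemma jinvertible_one_scaleR: "r \<noteq> 0 \<Longrightarrow> jinvertible (r *\<^sub>R 1)"
  unfolding jinvertible_def is_jinverse_def by (intro exI[of _ "inverse r *\<^sub>R 1"]) (simp add: jprod_lin)

lemma jinvertible_jpoly:
  assumes "q \<noteq> 0" "\<And>x. poly q x = 0 \<Longrightarrow> x \<notin> jspectrum a"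
  shows "jinvertible (jpoly q a)"
  using assms
proof (induction "degree q" arbitrary: q rule: less_induct)
  case less
  show ?case
  proof (cases "degree q = 0")
    case True
    then obtain c where "q = [:c:]" by (rule degree_eq_zeroE)
    then show ?thesis using less.prems jinvertible_one_scaleR[of c] by simp
  next
    case False
    then have "degree q > 0" by simp
    then show ?thesis
    proof (cases rule: real_poly_factor)
      case (linear c r)
      have "r \<noteq> 0" using less.prems linear by auto
      then have "degree r < degree q" unfolding linear by (subst degree_mult_eq) auto
      then have r: "jinvertible (jpoly r a)" using less linear \<open>r \<noteq> 0\<close> by auto
      have "c \<notin> jspectrum a" using less.prems(2)[of c] linear by simp
      then have "jinvertible (a - c *\<^sub>R 1)" by (simp add: jspectrum_def)
      moreover have "jpoly q a = (a - c *\<^sub>R 1) \<odot> jpoly r a"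
        unfolding linear jpoly_mult by simp
      ultimately show ?thesis
        using r jinvertible_mult[of "a - c *\<^sub>R 1" a "jpoly r a"]
        by (auto intro!: jgen_closed jpoly_in_jgen)
    next
      case (quadratic c b r)
      let ?Q = "[:- c, 1:] * [:- c, 1:] + [:b\<^sup>2:]"
      have Q: "?Q = [:c\<^sup>2 + b\<^sup>2, - 2 * c, 1:]" by (simp add: power2_eq_square)
      have "r \<noteq> 0" using less.prems quadratic by auto
      then have "degree r < degree q" unfolding quadratic Q by (subst degree_mult_eq) auto
      then have r: "jinvertible (jpoly r a)" using less quadratic \<open>r \<noteq> 0\<close> by auto
      let ?v = "a - c *\<^sub>R 1"
      have v: "?v \<in> jgen a" by (intro jgen_closed)
      obtain z where "z \<in> jgen a" "(?v \<odot> ?v + b\<^sup>2 *\<^sub>R 1) \<odot> z = 1"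
        using jgen_square_plus_invertible[OF v quadratic(1)] .
      then have "jinvertible (?v \<odot> ?v + b\<^sup>2 *\<^sub>R 1)"
        using jgen_inverse(1)[of "?v \<odot> ?v + b\<^sup>2 *\<^sub>R 1" a z] v by (blast intro: jgen_closed)
      moreover have "jpoly q a = (?v \<odot> ?v + b\<^sup>2 *\<^sub>R 1) \<odot> jpoly r a"
        unfolding quadratic jpoly_mult jpoly_add by simp
      ultimately show ?thesis
        using r v jinvertible_mult[of "?v \<odot> ?v + b\<^sup>2 *\<^sub>R 1" a "jpoly r a"]
        by (auto intro!: jgen_closed jpoly_in_jgen)
    qed
  qed
qed

text \<open>With \<open>N = \<parallel>p(a)\<parallel>\<close>, the element \<open>N\<^sup>2 - p(a)\<^sup>2\<close> is not invertible, so the polynomial \<open>N\<^sup>2 - p\<^sup>2\<close> is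
  zero or has a root in the spectrum. It can be zero only for constant \<open>p\<close>; the polynomial \<open>X\<close>
  shows that the spectrum is not empty, which settles that case.\<close>

lemma jpoly_norm_attained:
  assumes ne: "(1::'a::unital_jb_algebra) \<noteq> 0"
  obtains x where "x \<in> jspectrum (a::'a)" "\<bar>poly p x\<bar> = norm (jpoly p a)"
proof -
  have gen: "(\<exists>x\<in>jspectrum a. \<bar>poly p x\<bar> = norm (jpoly p a)) \<or> p = [:norm (jpoly p a):] \<or> p = [:- norm (jpoly p a):]" for p
  proof -
    let ?N = "norm (jpoly p a)"
    let ?q = "[:?N\<^sup>2:] - p * p"
    have px: "jpoly p a \<in> jgen a" by (intro jpoly_in_jgen jgen_self)
    have "jpoly ?q a = norm (jpoly p a \<odot> jpoly p a) *\<^sub>R 1 - jpoly p a \<odot> jpoly p a"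
      by (simp add: jpoly_diff jpoly_mult norm_jsquare)
    then have "\<not> jinvertible (jpoly ?q a)"
      using norm_square_minus_not_invertible[OF px _ ne]
      by (subst jinvertible_iff_jgen[of _ a]) (auto intro!: jgen_closed jpoly_in_jgen)
    then consider "?q = 0" | x where "poly ?q x = 0" "x \<in> jspectrum a"
      using jinvertible_jpoly[of ?q a] by blast
    then show ?thesis
    proof cases
      case 1
      have "([:?N:] - p) * ([:?N:] + p) = ?q" by (simp add: algebra_simps power2_eq_square)
      then have "[:?N:] - p = 0 \<or> [:?N:] + p = 0" using 1 by (metis mult_eq_0_iff)
      then have "p = [:?N:] \<or> p = - [:?N:]" by (metis eq_iff_diff_eq_0 add_eq_0_iff)
      then show ?thesis by simp
    next
      case 2
      then have "(poly p x)\<^sup>2 = ?N\<^sup>2" by (simp add: power2_eq_square)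
      then have "\<bar>poly p x\<bar> = ?N" 
        by (metis abs_norm_cancel real_sqrt_abs)
      with 2 show ?thesis by blast
    qed
  qed
  obtain y where y: "y \<in> jspectrum a" using gen[of "[:0,1:]"] by auto
  from gen[of p] show ?thesis
  proof (elim disjE)
    assume p: "p = [:norm (jpoly p a):]"
    then have "poly p y = norm (jpoly p a)" by (metis mult_zero_right poly_0 poly_pCons add.right_neutral)
    then show ?thesis using that[OF y] by simp
  next
    assume p: "p = [:- norm (jpoly p a):]"
    then have "poly p y = - norm (jpoly p a)" by (metis mult_zero_right poly_0 poly_pCons add.right_neutral)
    then show ?thesis using that[OF y] by simp
  qed (use that in blast)
qed

text \<open>The isometry of the functional calculus on polynomials, in the form in which it holds also for
  the zero algebra, whose elements have empty spectrum.\<close>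

lemma norm_jpoly_le:
  assumes "\<And>x. x \<in> jspectrum a \<Longrightarrow> \<bar>poly p x\<bar> \<le> M" "0 \<le> M"
  shows "norm (jpoly p (a::'a::unital_jb_algebra)) \<le> M"
proof (cases "(1::'a) = 0")
  case True
  then have "jpoly p a = 0" by (metis jprod.zero_right jprod_one_right)
  then show ?thesis using assms by simp
next
  case False
  then show ?thesis using jpoly_norm_attained[OF False, of a p] assms(1) by metis
qed

lemma jspectrum_bound:
  assumes "x \<in> jspectrum a" shows "\<bar>x\<bar> \<le> norm a"
proof (rule ccontr)
  assume x: "\<not> \<bar>x\<bar> \<le> norm a"
  then have x0: "\<bar>x\<bar> > 0" by (meson norm_ge_zero not_le order_le_less_trans)
  then have v: "(1/x) *\<^sub>R a \<in> jgen a" "norm ((1/x) *\<^sub>R a) < 1"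
    using x by (auto intro!: jgen_closed simp: field_simps)
  obtain z where z: "z \<in> jgen a" "(1 - (1/x) *\<^sub>R a) \<odot> z = 1" using jgen_neumann[OF v] .
  then have "(a - x *\<^sub>R 1) \<odot> ((- 1/x) *\<^sub>R z) = 1" using x0 by (simp add: jprod_lin algebra_simps)
  then have "jinvertible (a - x *\<^sub>R 1)"
    using z by (subst jinvertible_iff_jgen[of _ a]) (auto intro!: jgen_closed bexI[of _ "(- 1/x) *\<^sub>R z"])
  with assms show False by (simp add: jspectrum_def)
qed

lemma compact_jspectrum: "compact (jspectrum (a::'a::unital_jb_algebra))"
proof -
  have "open (- jspectrum a)"
    unfolding open_dist
  proof
    fix x assume "x \<in> - jspectrum a"
    then have "jinvertible (a - x *\<^sub>R 1)" by (simp add: jspectrum_def)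
    then obtain z where z: "z \<in> jgen a" "(a - x *\<^sub>R 1) \<odot> z = 1"
      using jinvertible_iff_jgen[of "a - x *\<^sub>R 1" a] by (auto intro: jgen_closed)
    show "\<exists>e>0. \<forall>y. dist y x < e \<longrightarrow> y \<in> - jspectrum a"
    proof (intro exI conjI allI impI)
      show "1 / (norm z + 1) > 0" by (simp add: add_nonneg_pos)
      fix y assume "dist y x < 1 / (norm z + 1)"
      then have "\<bar>y - x\<bar> * (norm z + 1) < 1"
        using pos_less_divide_eq[of "norm z + 1" "\<bar>y - x\<bar>" 1] by (simp add: dist_real_def add_nonneg_pos)
      then have v: "norm ((y - x) *\<^sub>R z) < 1"
        using abs_ge_zero[of "y - x"] by (simp add: distrib_left del: abs_ge_zero)
      obtain t where t: "t \<in> jgen a" "(1 - (y - x) *\<^sub>R z) \<odot> t = 1"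
        using jgen_neumann[OF jgen_scaleR[OF z(1)] v] .
      have g: "a - x *\<^sub>R 1 \<in> jgen a" "1 - (y - x) *\<^sub>R z \<in> jgen a" using z by (auto intro!: jgen_closed)
      have "(a - x *\<^sub>R 1) \<odot> (1 - (y - x) *\<^sub>R z) = a - y *\<^sub>R 1"
        using z(2) by (simp add: jprod_lin algebra_simps)
      moreover have "jinvertible (1 - (y - x) *\<^sub>R z)" "jinvertible (a - x *\<^sub>R 1)"
        using t z g by (auto simp: jinvertible_iff_jgen[OF g(1)] jinvertible_iff_jgen[OF g(2)])
      ultimately have "jinvertible (a - y *\<^sub>R 1)" using jinvertible_mult[OF g] by metis
      then show "y \<in> - jspectrum a" by (simp add: jspectrum_def)
    qed
  qed
  then have "closed (jspectrum a)" by (simp add: closed_def)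
  moreover have "bounded (jspectrum a)"
    using jspectrum_bound by (intro boundedI[of _ "norm a"]) auto
  ultimately show ?thesis by (simp add: compact_eq_bounded_closed)
qed

section \<open>Continuous functional calculus\<close>

lemma poly_fun_simps:
  fixes p q :: "'b::comm_ring poly"
  shows "poly (p + q) = (\<lambda>x. poly p x + poly q x)" "poly (p * q) = (\<lambda>x. poly p x * poly q x)"
    "poly (smult r p) = (\<lambda>x. r * poly p x)"
  by auto

text \<open>The description that defines \<open>jfun_calc\<close> is proper: by \<open>norm_jpoly_le\<close>, polynomials that converge
  uniformly on the spectrum give a Cauchy sequence in the algebra, and two such sequences with the
  same limit function have the same limit.\<close>

lemma jfun_calc_tendsto:
  assumes p: "uniform_limit (jspectrum a) (\<lambda>n. poly (p n)) f sequentially"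
  shows "(\<lambda>n. jpoly (p n) a) \<longlonglongrightarrow> jfun_calc f (a::'a::unital_jb_algebra)"
proof -
  have close: "\<forall>\<^sub>F n in sequentially. \<forall>x\<in>jspectrum a. \<bar>poly (q n) x - f x\<bar> < e"
    if "uniform_limit (jspectrum a) (\<lambda>n. poly (q n)) f sequentially" "e > 0" for q e
    using uniform_limitD[OF that] by (simp add: dist_real_def)
  have "Cauchy (\<lambda>n. jpoly (p n) a)"
  proof (rule metric_CauchyI)
    fix e :: real assume "e > 0"
    then obtain N where N: "\<And>n x. n \<ge> N \<Longrightarrow> x \<in> jspectrum a \<Longrightarrow> \<bar>poly (p n) x - f x\<bar> < e/3"
      using close[OF p, of "e/3"] unfolding eventually_sequentially by auto
    have "dist (jpoly (p m) a) (jpoly (p n) a) < e" if "m \<ge> N" "n \<ge> N" for m n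
    proof -
      have "norm (jpoly (p m - p n) a) \<le> 2*e/3"
        by (rule norm_jpoly_le) (use N[OF that(1)] N[OF that(2)] \<open>e > 0\<close> in \<open>force simp: abs_if split: if_splits\<close>)+
      then show ?thesis using \<open>e > 0\<close> by (simp add: dist_norm jpoly_diff)
    qed
    then show "\<exists>M. \<forall>m\<ge>M. \<forall>n\<ge>M. dist (jpoly (p m) a) (jpoly (p n) a) < e" by blast
  qed
  then obtain B where B: "(\<lambda>n. jpoly (p n) a) \<longlonglongrightarrow> B" by (auto simp: Cauchy_convergent_iff convergent_def)
  have uniq: "C = B" if q: "uniform_limit (jspectrum a) (\<lambda>n. poly (q n)) f sequentially"
    and C: "(\<lambda>n. jpoly (q n) a) \<longlonglongrightarrow> C" for q C
  proof -
    have "(\<lambda>n. jpoly (q n) a - jpoly (p n) a) \<longlonglongrightarrow> 0"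
      unfolding tendsto_iff
    proof (intro allI impI)
      fix e :: real assume "e > 0"
      then have "e/3 > 0" by simp
      from close[OF p this] close[OF q this]
      show "\<forall>\<^sub>F n in sequentially. dist (jpoly (q n) a - jpoly (p n) a) 0 < e"
      proof eventually_elim
        case (elim n)
        have "norm (jpoly (q n - p n) a) \<le> 2*e/3"
          by (rule norm_jpoly_le) (use elim \<open>e > 0\<close> in \<open>force simp: abs_if split: if_splits\<close>)+
        then show ?case using \<open>e > 0\<close> by (simp add: jpoly_diff)
      qed
    qed
    with tendsto_diff[OF C B] have "C - B = 0" by (rule LIMSEQ_unique)
    then show ?thesis by simp
  qed
  have "jfun_calc f a = B"
    unfolding jfun_calc_def by (rule the_equality) (use p B uniq in blast)+
  with B show ?thesis by simp
qed

lemma jfun_calc_eqI: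
  assumes "uniform_limit (jspectrum a) (\<lambda>n. poly (p n)) f sequentially" "(\<lambda>n. jpoly (p n) a) \<longlonglongrightarrow> B"
  shows "jfun_calc f a = B"
  using jfun_calc_tendsto[OF assms(1)] assms(2) by (rule LIMSEQ_unique)

lemma jfun_calc_poly: "jfun_calc (poly p) a = jpoly p a"
  by (rule jfun_calc_eqI[where p = "\<lambda>_. p"]) (auto simp: uniform_limit_const)

lemma jfun_calc_cong:
  assumes "\<And>x. x \<in> jspectrum a \<Longrightarrow> f x = g x"
  shows "jfun_calc f a = jfun_calc g a"
proof -
  have "uniform_limit (jspectrum a) h f sequentially = uniform_limit (jspectrum a) h g sequentially" for h :: "nat \<Rightarrow> _"
    using assms by (intro uniform_limit_cong') auto
  then show ?thesis by (simp add: jfun_calc_def)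
qed

lemma poly_approximation:
  fixes f :: "real \<Rightarrow> real"
  assumes "compact S" "continuous_on S f"
  obtains p where "uniform_limit S (\<lambda>n. poly (p n)) f sequentially"
proof -
  obtain g where g: "uniform_limit S g f sequentially" "\<And>n. polynomial_function (g n :: real \<Rightarrow> real)"
    using Stone_Weierstrass_uniform_limit[OF assms] by blast
  have "\<exists>p. g n = poly p" for n
  proof -
    have "real_polynomial_function (g n)" using g by (simp add: real_polynomial_function_eq)
    then obtain c N where "g n = (\<lambda>x. \<Sum>i\<le>N. c i * x ^ i)"
      unfolding real_polynomial_function_iff_sum by blast
    then have "g n = poly (\<Sum>i\<le>N. monom (c i) i)" by (auto simp: poly_sum poly_monom)
    then show ?thesis by blast
  qed
  then obtain p where "\<And>n. g n = poly (p n)" by metis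
  then have "g = (\<lambda>n. poly (p n))" by auto
  with g(1) that show ?thesis by blast
qed

context
  fixes a :: "'a::unital_jb_algebra" and f :: "real \<Rightarrow> real"
  assumes f: "continuous_on (jspectrum a) f"
begin

lemma jfun_calc_approx:
  obtains p where "uniform_limit (jspectrum a) (\<lambda>n. poly (p n)) f sequentially"
    "(\<lambda>n. jpoly (p n) a) \<longlonglongrightarrow> jfun_calc f a"
  using poly_approximation[OF compact_jspectrum f] jfun_calc_tendsto by metis

lemma jfun_calc_in_jgen: "jfun_calc f a \<in> jgen a"
proof -
  obtain p where "(\<lambda>n. jpoly (p n) a) \<longlonglongrightarrow> jfun_calc f a" using jfun_calc_approx .
  then show ?thesis
    by (rule closed_sequentially[OF closed_jgen, rotated]) (intro jpoly_in_jgen jgen_self)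
qed

lemma norm_jfun_calc_le:
  assumes M: "\<And>x. x \<in> jspectrum a \<Longrightarrow> \<bar>f x\<bar> \<le> M" "0 \<le> M"
  shows "norm (jfun_calc f a) \<le> M"
proof (rule field_le_epsilon)
  fix e :: real assume e: "e > 0"
  obtain p where p: "uniform_limit (jspectrum a) (\<lambda>n. poly (p n)) f sequentially"
    "(\<lambda>n. jpoly (p n) a) \<longlonglongrightarrow> jfun_calc f a" using jfun_calc_approx .
  have "\<forall>\<^sub>F n in sequentially. norm (jpoly (p n) a) \<le> M + e"
    using uniform_limitD[OF p(1) e]
  proof eventually_elim
    case (elim n)
    show ?case
      by (rule norm_jpoly_le) (use elim M e in \<open>force simp: dist_real_def abs_if split: if_splits\<close>)+
  qed
  then show "norm (jfun_calc f a) \<le> M + e"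
    by (intro tendsto_upperbound[OF tendsto_norm[OF p(2)]]) auto
qed

lemma jfun_calc_scaleR: "jfun_calc (\<lambda>x. r * f x) a = r *\<^sub>R jfun_calc f a"
proof -
  obtain p where p: "uniform_limit (jspectrum a) (\<lambda>n. poly (p n)) f sequentially"
    "(\<lambda>n. jpoly (p n) a) \<longlonglongrightarrow> jfun_calc f a" using jfun_calc_approx .
  show ?thesis
    by (rule jfun_calc_eqI[where p = "\<lambda>n. smult r (p n)"])
      (use p(2) in \<open>auto simp: jpoly_smult poly_fun_simps intro!: tendsto_intros bounded_linear.uniform_limit[OF bounded_linear_mult_right p(1)]\<close>)
qed

context
  fixes g :: "real \<Rightarrow> real"
  assumes g: "continuous_on (jspectrum a) g"
begin

lemma jfun_calc_add: "jfun_calc (\<lambda>x. f x + g x) a = jfun_calc f a + jfun_calc g a"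
proof -
  obtain p where p: "uniform_limit (jspectrum a) (\<lambda>n. poly (p n)) f sequentially"
    "(\<lambda>n. jpoly (p n) a) \<longlonglongrightarrow> jfun_calc f a" using jfun_calc_approx .
  obtain q where q: "uniform_limit (jspectrum a) (\<lambda>n. poly (q n)) g sequentially"
    "(\<lambda>n. jpoly (q n) a) \<longlonglongrightarrow> jfun_calc g a"
    using poly_approximation[OF compact_jspectrum g] jfun_calc_tendsto by metis
  show ?thesis
    by (rule jfun_calc_eqI[where p = "\<lambda>n. p n + q n"])
      (use uniform_limit_add[OF p(1) q(1)] tendsto_add[OF p(2) q(2)] in \<open>simp_all add: jpoly_add poly_fun_simps\<close>)
qed

lemma jfun_calc_mult: "jfun_calc (\<lambda>x. f x * g x) a = jfun_calc f a \<odot> jfun_calc g a"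
proof -
  obtain p where p: "uniform_limit (jspectrum a) (\<lambda>n. poly (p n)) f sequentially"
    "(\<lambda>n. jpoly (p n) a) \<longlonglongrightarrow> jfun_calc f a" using jfun_calc_approx .
  obtain q where q: "uniform_limit (jspectrum a) (\<lambda>n. poly (q n)) g sequentially"
    "(\<lambda>n. jpoly (q n) a) \<longlonglongrightarrow> jfun_calc g a"
    using poly_approximation[OF compact_jspectrum g] jfun_calc_tendsto by metis
  have "bounded (f ` jspectrum a)" "bounded (g ` jspectrum a)"
    using f g by (auto intro!: compact_imp_bounded compact_continuous_image compact_jspectrum)
  then show ?thesis
    by (intro jfun_calc_eqI[where p = "\<lambda>n. p n * q n"])
      (use uniform_lim_mult[OF p(1) q(1)] jprod.tendsto[OF p(2) q(2)] in \<open>simp_all add: jpoly_mult poly_fun_simps\<close>)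
qed

end

end

lemma jfun_calc_const: "jfun_calc (\<lambda>x. c) a = c *\<^sub>R 1"
proof -
  have "poly [:c:] = (\<lambda>x. c)" by auto
  then show ?thesis using jfun_calc_poly[of "[:c:]" a] by simp
qed

lemma jfun_calc_id: "jfun_calc (\<lambda>x. x) a = a"
proof -
  have "poly [:0, 1:] = (\<lambda>x::real. x)" by auto
  then show ?thesis using jfun_calc_poly[of "[:0,1:]" a] by simp
qed

lemma jspectrum_shift: "jspectrum (a - r *\<^sub>R 1) = (\<lambda>x. x - r) ` jspectrum a"
proof -
  have "a - r *\<^sub>R 1 - x *\<^sub>R 1 = a - (x + r) *\<^sub>R 1" for x by (simp add: algebra_simps)
  then have "x \<in> jspectrum (a - r *\<^sub>R 1) \<longleftrightarrow> x + r \<in> jspectrum a" for x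
    unfolding jspectrum_def mem_Collect_eq by (simp only:)
  moreover have "x \<in> (\<lambda>x. x - r) ` S \<longleftrightarrow> x + r \<in> S" for x :: real and S
    by (force simp: image_iff)
  ultimately show ?thesis by blast
qed

text \<open>One inclusion of the spectral mapping theorem: off the image, \<open>1 / (f - r)\<close> is continuous on the
  spectrum and gives an inverse. The inclusion makes the range of \<open>f\<close> a sufficient domain for
  the outer function of a composition.\<close>

lemma jspectrum_jfun_calc:
  assumes f: "continuous_on (jspectrum a) f"
  shows "jspectrum (jfun_calc f a) \<subseteq> f ` jspectrum a"
proof
  fix r assume r: "r \<in> jspectrum (jfun_calc f a)"
  show "r \<in> f ` jspectrum a"
  proof (rule ccontr)
    assume nr: "r \<notin> f ` jspectrum a"
    have c: "continuous_on (jspectrum a) (\<lambda>x. f x + (- r))"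
      "continuous_on (jspectrum a) (\<lambda>x. inverse (f x + (- r)))"
      using f nr by (auto intro!: continuous_intros)
    have "jfun_calc f a - r *\<^sub>R 1 = jfun_calc (\<lambda>x. f x + (- r)) a"
      using f by (subst jfun_calc_add) (auto simp: jfun_calc_const)
    moreover have "jfun_calc (\<lambda>x. f x + (- r)) a \<odot> jfun_calc (\<lambda>x. inverse (f x + (- r))) a = 1"
    proof -
      have "jfun_calc (\<lambda>x. (f x + (- r)) * inverse (f x + (- r))) a = jfun_calc (\<lambda>x. 1) a"
        using nr by (intro jfun_calc_cong) (auto simp: image_iff)
      then show ?thesis using jfun_calc_mult[OF c] by (simp add: jfun_calc_const)
    qed
    ultimately have "jinvertible (jfun_calc f a - r *\<^sub>R 1)"
      using jgen_inverse(1)[OF jfun_calc_in_jgen[OF c(1)] jfun_calc_in_jgen[OF c(2)]] by simp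
    with r show False by (simp add: jspectrum_def)
  qed
qed

lemma jfun_calc_compose:
  assumes f: "continuous_on (jspectrum a) f" and g: "continuous_on (f ` jspectrum a) g"
  shows "jfun_calc g (jfun_calc f a) = jfun_calc (\<lambda>x. g (f x)) a"
proof -
  have "compact (f ` jspectrum a)" by (intro compact_continuous_image f compact_jspectrum)
  then obtain q where q: "uniform_limit (f ` jspectrum a) (\<lambda>n. poly (q n)) g sequentially"
    using poly_approximation g by metis
  have cq: "continuous_on (jspectrum a) (\<lambda>x. poly p (f x))" for p
    using f by (intro continuous_intros)
  have qf: "jpoly p (jfun_calc f a) = jfun_calc (\<lambda>x. poly p (f x)) a" for p
  proof (induction p)
    case 0
    then show ?case by (simp add: jfun_calc_const)
  next
    case (pCons c p)
    then show ?case
      using f cq by (simp add: jfun_calc_add jfun_calc_mult jfun_calc_const continuous_intros)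
  qed
  have cg: "continuous_on (jspectrum a) (\<lambda>x. g (f x))"
    using continuous_on_compose2[OF g f] by auto
  have "(\<lambda>n. jpoly (q n) (jfun_calc f a)) \<longlonglongrightarrow> jfun_calc (\<lambda>x. g (f x)) a"
    unfolding tendsto_iff
  proof (intro allI impI)
    fix e :: real assume "e > 0"
    then have "e/2 > 0" by simp
    from uniform_limitD[OF q this]
    show "\<forall>\<^sub>F n in sequentially. dist (jpoly (q n) (jfun_calc f a)) (jfun_calc (\<lambda>x. g (f x)) a) < e"
    proof eventually_elim
      case (elim n)
      have "jpoly (q n) (jfun_calc f a) - jfun_calc (\<lambda>x. g (f x)) a
        = jfun_calc (\<lambda>x. poly (q n) (f x) + (- 1) * g (f x)) a"
        unfolding qf using cg by (subst jfun_calc_add[OF cq]) (use jfun_calc_scaleR[OF cg, of "- 1"] in \<open>auto intro!: continuous_intros\<close>)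
      also have "norm \<dots> \<le> e/2"
        using elim \<open>e > 0\<close> cq cg
        by (intro norm_jfun_calc_le continuous_on_add continuous_on_mult continuous_on_const) (auto simp: dist_real_def less_imp_le)
      finally show ?case using \<open>e > 0\<close> by (simp add: dist_norm)
    qed
  qed
  moreover have "uniform_limit (jspectrum (jfun_calc f a)) (\<lambda>n. poly (q n)) g sequentially"
    using uniform_limit_on_subset[OF q jspectrum_jfun_calc[OF f]] .
  ultimately show ?thesis by (intro jfun_calc_eqI)
qed

section \<open>The positive cone\<close>

lemma jpositive_jfun_calc:
  assumes "continuous_on (jspectrum a) f" "\<And>x. x \<in> jspectrum a \<Longrightarrow> f x \<ge> 0"
  shows "jpositive (jfun_calc f a)"
  unfolding jpositive_def using jspectrum_jfun_calc[OF assms(1)] assms(2) by auto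

lemma jpositive_jpoly:
  assumes "\<And>x. x \<in> jspectrum a \<Longrightarrow> poly p x \<ge> 0"
  shows "jpositive (jpoly p a)"
  unfolding jfun_calc_poly[symmetric] using assms by (intro jpositive_jfun_calc continuous_intros)

lemma jpositive_square: "jpositive (a \<odot> a)"
  using jpositive_jpoly[of a "[:0, 0, 1:]"] by simp

lemma jinvertible_minus:
  assumes "jinvertible a" shows "jinvertible (- a)"
proof -
  obtain b where "is_jinverse a b" using assms by (auto simp: jinvertible_def)
  then have "is_jinverse (- a) (- b)"
    by (simp add: is_jinverse_def jprod.minus_left jprod.minus_right)
  then show ?thesis by (auto simp: jinvertible_def)
qed

text \<open>This description of positivity by the norm is what makes the positive elements a closed convex
  cone.\<close>

lemma jpositive_iff_norm:
  assumes M: "norm a \<le> M"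
  shows "jpositive a \<longleftrightarrow> norm (M *\<^sub>R 1 - a) \<le> M"
proof
  assume a: "jpositive a"
  have "norm (jpoly [:M, -1:] a) \<le> M"
  proof (rule norm_jpoly_le)
    show "\<bar>poly [:M, -1:] x\<bar> \<le> M" if "x \<in> jspectrum a" for x
      using a M jspectrum_bound[OF that] that by (auto simp: jpositive_def abs_if)
    show "0 \<le> M" using M norm_ge_zero order_trans by blast
  qed
  then show "norm (M *\<^sub>R 1 - a) \<le> M" by (simp add: jprod_lin)
next
  assume N: "norm (M *\<^sub>R 1 - a) \<le> M"
  show "jpositive a"
    unfolding jpositive_def
  proof
    fix x assume x: "x \<in> jspectrum a"
    have "M - x \<in> jspectrum (M *\<^sub>R 1 - a)"
    proof (rule ccontr)
      assume "M - x \<notin> jspectrum (M *\<^sub>R 1 - a)"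
      moreover have "M *\<^sub>R 1 - a - (M - x) *\<^sub>R 1 = - (a - x *\<^sub>R 1)" by (simp add: algebra_simps)
      ultimately have "jinvertible (- (a - x *\<^sub>R 1))" by (simp add: jspectrum_def)
      then have "jinvertible (a - x *\<^sub>R 1)" using jinvertible_minus[of "- (a - x *\<^sub>R 1)"] by simp
      with x show False by (simp add: jspectrum_def)
    qed
    from jspectrum_bound[OF this] N show "x \<in> {0..}" by auto
  qed
qed

lemma jpositive_add:
  assumes "jpositive a" "jpositive b" shows "jpositive (a + b)"
proof -
  have "norm (norm a *\<^sub>R 1 - a) \<le> norm a" "norm (norm b *\<^sub>R 1 - b) \<le> norm b"
    using assms jpositive_iff_norm by blast+
  moreover have "(norm a + norm b) *\<^sub>R 1 - (a + b) = (norm a *\<^sub>R 1 - a) + (norm b *\<^sub>R 1 - b)"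
    by (simp add: algebra_simps)
  ultimately have "norm ((norm a + norm b) *\<^sub>R 1 - (a + b)) \<le> norm a + norm b"
    by (metis norm_triangle_mono)
  then show ?thesis using jpositive_iff_norm[OF norm_triangle_ineq[of a b]] by blast
qed

lemma jpositive_scaleR:
  assumes "jpositive a" "0 \<le> r" shows "jpositive (r *\<^sub>R a)"
proof -
  have "jpositive (jpoly [:0, r:] a)"
    using assms by (intro jpositive_jpoly) (auto simp: jpositive_def)
  then show ?thesis by (simp add: jprod_lin)
qed

lemma jpositive_scaleR_one: "0 \<le> r \<Longrightarrow> jpositive (r *\<^sub>R 1)"
  using jpositive_square[of "sqrt r *\<^sub>R 1"] by (simp add: jprod_lin)

lemma jpositive_0: "jpositive 0"
  using jpositive_scaleR_one[of 0] by simp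

lemma jpositive_add_one_mono:
  assumes "jpositive (x + r *\<^sub>R 1)" "r \<le> s" shows "jpositive (x + s *\<^sub>R 1)"
  using jpositive_add[OF assms(1) jpositive_scaleR_one[of "s - r"]] assms(2) by (simp add: algebra_simps)

lemma jpositive_norm_plus: "jpositive (norm h *\<^sub>R 1 + h)"
proof -
  have n: "norm (norm h *\<^sub>R (1::'a)) \<le> norm h" using norm_scaleR_one_le[of "norm h", where 'a='a] by simp
  have "norm (norm h *\<^sub>R 1 + h) \<le> 2 * norm h"
    using n norm_triangle_ineq[of "norm h *\<^sub>R 1" h] by simp
  moreover have "(2 * norm h) *\<^sub>R 1 - (norm h *\<^sub>R 1 + h) = norm h *\<^sub>R 1 - h"
    by (simp add: algebra_simps scaleR_2 flip: scaleR_scaleR)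
  moreover have "norm (norm h *\<^sub>R 1 - h) \<le> 2 * norm h"
    using n norm_triangle_ineq4[of "norm h *\<^sub>R 1" h] by simp
  ultimately show ?thesis using jpositive_iff_norm by metis
qed

lemma jpositive_norm_minus: "jpositive (norm h *\<^sub>R 1 - h)"
  using jpositive_norm_plus[of "- h"] by simp

lemma jpositive_limit:
  assumes f: "f \<longlonglongrightarrow> a" and pos: "\<forall>\<^sub>F n in sequentially. jpositive (f n)"
  shows "jpositive a"
proof -
  let ?M = "norm a + 1"
  have "\<forall>\<^sub>F n in sequentially. norm (f n) < ?M"
    using tendsto_norm[OF f] by (rule order_tendstoD) simp
  with pos have "\<forall>\<^sub>F n in sequentially. norm (?M *\<^sub>R 1 - f n) \<le> ?M"
    by eventually_elim (simp flip: jpositive_iff_norm)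
  then have "norm (?M *\<^sub>R 1 - a) \<le> ?M"
    by (intro tendsto_upperbound[OF tendsto_norm[OF tendsto_diff[OF tendsto_const f]]]) auto
  then show ?thesis by (simp add: jpositive_iff_norm[of a ?M])
qed

lemma jpos_cone_iff_spectrum: "a \<in> jpos_cone \<longleftrightarrow> jspectrum a \<subseteq> {0<..}"
proof -
  have "0 \<in> jspectrum a \<longleftrightarrow> \<not> jinvertible a" by (simp add: jspectrum_def)
  then show ?thesis
    by (auto simp: jpos_cone_def jpositive_def subset_eq order_less_le)
qed

lemma spectrum_lower_bound:
  assumes "a \<in> jpos_cone"
  obtains e where "e > 0" "\<And>x. x \<in> jspectrum a \<Longrightarrow> e \<le> x"
proof (cases "jspectrum a = {}")
  case True
  then show ?thesis using that[of 1] by simp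
next
  case False
  then obtain e where "e \<in> jspectrum a" "\<And>x. x \<in> jspectrum a \<Longrightarrow> e \<le> x"
    using compact_attains_inf[OF compact_jspectrum] by metis
  then show ?thesis using that[of e] assms by (auto simp: jpos_cone_iff_spectrum)
qed

text \<open>The lower bound \<open>e\<close> exists because the spectrum is compact; it makes openness and the
  permanence properties of the cone consequences of those of positivity.\<close>

lemma jpos_cone_iff: "a \<in> jpos_cone \<longleftrightarrow> (\<exists>e>0. jpositive (a - e *\<^sub>R 1))"
proof
  assume "a \<in> jpos_cone"
  then obtain e where e: "e > 0" "\<And>x. x \<in> jspectrum a \<Longrightarrow> e \<le> x"
    using spectrum_lower_bound by blast
  then show "\<exists>e>0. jpositive (a - e *\<^sub>R 1)"
    by (intro exI[of _ e]) (auto simp: jpositive_def jspectrum_shift)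
next
  assume "\<exists>e>0. jpositive (a - e *\<^sub>R 1)"
  then show "a \<in> jpos_cone"
    unfolding jpos_cone_iff_spectrum jpositive_def jspectrum_shift by (auto simp: subset_eq intro: less_le_trans)
qed

lemma jpos_cone_jpositive: "a \<in> jpos_cone \<Longrightarrow> jpositive a"
  by (simp add: jpos_cone_def)

lemma jpos_cone_add:
  assumes "a \<in> jpos_cone" "jpositive b" shows "a + b \<in> jpos_cone"
  using assms jpositive_add[of "a - _ *\<^sub>R 1" b] unfolding jpos_cone_iff
  by (metis add_diff_eq diff_add_eq)

lemma jpos_cone_scaleR:
  assumes "a \<in> jpos_cone" "0 < r" shows "r *\<^sub>R a \<in> jpos_cone"
proof -
  obtain e where "e > 0" "jpositive (a - e *\<^sub>R 1)" using assms jpos_cone_iff by auto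
  then have "jpositive (r *\<^sub>R a - (r * e) *\<^sub>R 1)" "r * e > 0"
    using jpositive_scaleR[of "a - e *\<^sub>R 1" r] assms by (auto simp: scaleR_diff_right)
  then show ?thesis using jpos_cone_iff by blast
qed

lemma jpos_cone_one: "1 \<in> jpos_cone"
  unfolding jpos_cone_iff using jpositive_0 by (intro exI[of _ 1]) simp

lemma open_jpos_cone: "open (jpos_cone :: 'a::unital_jb_algebra set)"
  unfolding open_dist
proof
  fix a :: 'a assume "a \<in> jpos_cone"
  then obtain e where e: "e > 0" "jpositive (a - e *\<^sub>R 1)" using jpos_cone_iff by auto
  have "b \<in> jpos_cone" if "dist b a < e/2" for b
  proof -
    have "jpositive ((a - e *\<^sub>R 1) + (norm (b - a) *\<^sub>R 1 + (b - a)))"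
      by (intro jpositive_add e jpositive_norm_plus)
    then have "jpositive (b - (e - norm (b - a)) *\<^sub>R 1)" by (simp add: algebra_simps)
    moreover have "e - norm (b - a) > 0" using that e by (simp add: dist_norm)
    ultimately show ?thesis using jpos_cone_iff by blast
  qed
  then show "\<exists>e>0. \<forall>y. dist y a < e \<longrightarrow> y \<in> jpos_cone" using e(1) by (intro exI[of _ "e/2"]) auto
qed

section \<open>Real powers\<close>

lemma jpos_cone_jfun_calc:
  assumes "continuous_on (jspectrum a) f" "\<And>x. x \<in> jspectrum a \<Longrightarrow> f x > 0"
  shows "jfun_calc f a \<in> jpos_cone"
  unfolding jpos_cone_iff_spectrum using jspectrum_jfun_calc[OF assms(1)] assms(2) by auto

lemma spectrum_pos: "a \<in> jpos_cone \<Longrightarrow> x \<in> jspectrum a \<Longrightarrow> 0 < x"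
  by (auto simp: jpos_cone_iff_spectrum)

context
  fixes a :: "'a::unital_jb_algebra"
  assumes a: "a \<in> jpos_cone"
begin

lemma continuous_on_spectrum_powr: "continuous_on (jspectrum a) (\<lambda>x. x powr r)"
  using spectrum_pos[OF a] by (auto intro!: continuous_intros)

lemma jpowr_in_jgen: "a jpowr r \<in> jgen a"
  unfolding jpowr_def by (intro jfun_calc_in_jgen continuous_on_spectrum_powr)

lemma jpowr_in_cone: "a jpowr r \<in> jpos_cone"
  unfolding jpowr_def using spectrum_pos[OF a]
  by (intro jpos_cone_jfun_calc continuous_on_spectrum_powr) auto

lemma jpowr_mult: "a jpowr r \<odot> a jpowr s = a jpowr (r + s)"
  unfolding jpowr_def by (simp add: powr_add jfun_calc_mult continuous_on_spectrum_powr)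

lemma jpowr_one: "a jpowr 1 = a"
proof -
  have "jfun_calc (\<lambda>x. x powr 1) a = jfun_calc (\<lambda>x. x) a"
    using spectrum_pos[OF a] by (intro jfun_calc_cong powr_one) (simp add: less_imp_le)
  then show ?thesis by (simp add: jpowr_def jfun_calc_id)
qed

lemma jpowr_zero: "a jpowr 0 = 1"
proof -
  have "jfun_calc (\<lambda>x. x powr 0) a = jfun_calc (\<lambda>x. 1) a"
    using spectrum_pos[OF a] by (intro jfun_calc_cong) auto
  then show ?thesis by (simp add: jpowr_def jfun_calc_const)
qed

lemma jpowr_jpowr: "(a jpowr r) jpowr s = a jpowr (r * s)"
proof -
  have "continuous_on ((\<lambda>x. x powr r) ` jspectrum a) (\<lambda>x. x powr s)"
    using spectrum_pos[OF a] by (intro continuous_intros) auto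
  then show ?thesis
    unfolding jpowr_def by (simp add: jfun_calc_compose continuous_on_spectrum_powr powr_powr)
qed

lemma jinv_eq_jpowr: "jinv a = a jpowr - 1"
  using jpowr_mult[of 1 "- 1"] jgen_inverse(2)[OF jgen_self jpowr_in_jgen[of "- 1"]]
  by (simp add: jpowr_one jpowr_zero)

end

lemma jspectrum_one: "x \<in> jspectrum (1::'a::unital_jb_algebra) \<Longrightarrow> x = 1"
proof (rule ccontr)
  assume x: "x \<in> jspectrum (1::'a)" "x \<noteq> 1"
  then have "jinvertible ((1 - x) *\<^sub>R (1::'a))" by (intro jinvertible_one_scaleR) simp
  with x show False by (simp add: jspectrum_def scaleR_left_diff_distrib)
qed

lemma one_jpowr: "(1::'a::unital_jb_algebra) jpowr r = 1"
proof -
  have "jfun_calc (\<lambda>x. x powr r) (1::'a) = jfun_calc (\<lambda>x. 1) 1"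
    by (intro jfun_calc_cong) (metis jspectrum_one powr_one_eq_one)
  then show ?thesis by (simp add: jpowr_def jfun_calc_const)
qed

section \<open>Positivity of the triple product\<close>

text \<open>With \<open>M = \<parallel>x\<parallel>\<close>, the element is the sum of \<open>(M x - x\<^sup>2) / M\<close>, the square of \<open>x / \<surd>M + \<surd>M h\<close>, and
  \<open>M (\<parallel>h\<^sup>2\<parallel> - h\<^sup>2)\<close>, all of which are positive.\<close>

lemma jpositive_near_one:
  assumes x: "jpositive x"
  shows "jpositive (x + 2 *\<^sub>R (h \<odot> x) + (norm x * norm h ^ 2) *\<^sub>R 1)"
proof (cases "x = 0")
  case True
  then show ?thesis by (simp add: jpositive_0)
next
  case False
  define M where "M = norm x"
  have M: "M > 0" using False by (simp add: M_def)
  let ?y = "(1 / sqrt M) *\<^sub>R x + sqrt M *\<^sub>R h"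
  have y: "?y \<odot> ?y = (1/M) *\<^sub>R (x \<odot> x) + 2 *\<^sub>R (h \<odot> x) + M *\<^sub>R (h \<odot> h)"
    using M by (simp add: jprod_lin jprod_commute[of x h] scaleR_2 algebra_simps)
  have "jpositive (jpoly [:0, M, -1:] x)"
  proof (rule jpositive_jpoly)
    fix t assume t: "t \<in> jspectrum x"
    then have "0 \<le> t" "t \<le> M" using x jspectrum_bound[OF t] by (auto simp: jpositive_def M_def)
    then have "0 \<le> t * (M - t)" by simp
    then show "0 \<le> poly [:0, M, -1:] t" by (simp add: algebra_simps)
  qed
  then have "jpositive (M *\<^sub>R x - x \<odot> x)" by (simp add: jprod_lin)
  then have "jpositive ((1/M) *\<^sub>R (M *\<^sub>R x - x \<odot> x) + (?y \<odot> ?y) + M *\<^sub>R (norm (h \<odot> h) *\<^sub>R 1 - h \<odot> h))"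
    using M by (intro jpositive_add jpositive_scaleR jpositive_square jpositive_norm_minus) auto
  also have "(1/M) *\<^sub>R (M *\<^sub>R x - x \<odot> x) + (?y \<odot> ?y) + M *\<^sub>R (norm (h \<odot> h) *\<^sub>R 1 - h \<odot> h)
    = x + 2 *\<^sub>R (h \<odot> x) + (norm x * norm h ^ 2) *\<^sub>R 1"
    unfolding y using M by (simp add: norm_jsquare scaleR_diff_right M_def[symmetric])
  finally show ?thesis .
qed

lemma jtriple_one_plus: "jtriple (1 + h) x = x + 2 *\<^sub>R (h \<odot> x) + jtriple h x"
  by (simp add: jtriple_alt jprod_lin scaleR_2 algebra_simps)

text \<open>Positivity of \<open>U(1 + h)\<close> up to second order in \<open>h\<close>: the first-order part \<open>x + 2 h \<odot> x\<close> is covered by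
  \<open>jpositive_near_one\<close>, and \<open>U(h) x\<close> is itself of second order.\<close>

lemma jpositive_jtriple_near_one:
  assumes x: "jpositive x"
  shows "jpositive (jtriple (1 + h) x + (4 * norm h ^ 2 * norm x) *\<^sub>R 1)"
proof -
  have "jpositive ((x + 2 *\<^sub>R (h \<odot> x) + (norm x * norm h ^ 2) *\<^sub>R 1)
      + (jtriple h x + norm (jtriple h x) *\<^sub>R 1))"
    using jpositive_norm_plus[of "jtriple h x"]
    by (intro jpositive_add[OF jpositive_near_one[OF x]]) (simp add: add.commute)
  then have "jpositive (jtriple (1 + h) x + (norm x * norm h ^ 2 + norm (jtriple h x)) *\<^sub>R 1)"
    by (simp add: jtriple_one_plus algebra_simps)
  then show ?thesis
    by (rule jpositive_add_one_mono) (use norm_jtriple_le[of h x] in \<open>simp add: algebra_simps\<close>)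
qed

lemma norm_jtriple_near_one:
  assumes "norm h \<le> 1"
  shows "norm (jtriple (1 + h) x) \<le> (1 + 5 * norm h) * norm x"
proof -
  have "norm (jtriple (1 + h) x) \<le> norm x + norm (2 *\<^sub>R (h \<odot> x)) + norm (jtriple h x)"
    unfolding jtriple_one_plus by (metis add_right_mono norm_triangle_ineq order_trans)
  also have "\<dots> \<le> norm x + 2 * (norm h * norm x) + 3 * norm h * norm x"
  proof (intro add_mono)
    have "norm (jtriple h x) \<le> 3 * norm h ^ 2 * norm x" by (rule norm_jtriple_le)
    also have "\<dots> \<le> 3 * norm h * norm x"
      using assms by (intro mult_right_mono mult_left_mono) (auto simp: power2_eq_square mult_left_le)
    finally show "norm (jtriple h x) \<le> 3 * norm h * norm x" .
  qed (use norm_jprod_le[of h x] in auto)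
  finally show ?thesis by (simp add: algebra_simps)
qed

text \<open>The negative part \<open>c\<close> after \<open>n\<close> steps grows by at most the factor \<open>G\<close> and a second-order term in
  each step. When \<open>h\<close> is of order \<open>1 / n\<close>, the powers \<open>G\<^sup>n\<close> are bounded and the total is of order \<open>1 / n\<close>.\<close>

lemma jpositive_jtriple_iterate:
  assumes x: "jpositive x" and h: "norm h \<le> 1"
  defines "G \<equiv> 1 + 9 * norm h"
  shows "jpositive ((jtriple (1 + h) ^^ n) x + (n * (4 * norm h ^ 2) * G ^ n * norm x) *\<^sub>R 1)
    \<and> norm ((jtriple (1 + h) ^^ n) x) \<le> G ^ n * norm x"
proof (induction n)
  case 0
  then show ?case using x by simp
next
  case (Suc n)
  define y where "y = (jtriple (1 + h) ^^ n) x"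
  define e where "e = 4 * norm h ^ 2"
  define c where "c = n * e * G ^ n * norm x"
  have G: "1 \<le> G" "1 + 5 * norm h \<le> G" by (auto simp: G_def)
  have e: "0 \<le> e" "1 + 5 * norm h + e \<le> G"
    using h by (auto simp: e_def G_def power2_eq_square mult_left_le)
  have c: "0 \<le> c" using e(1) G by (simp add: c_def)
  have y: "jpositive (y + c *\<^sub>R 1)" "norm y \<le> G ^ n * norm x"
    using Suc unfolding y_def c_def e_def by auto
  have ny: "norm (y + c *\<^sub>R 1) \<le> G ^ n * norm x + c"
    using norm_triangle_ineq[of y "c *\<^sub>R 1"] norm_scaleR_one_le[of c, where 'a='a] y(2) c by simp
  have "norm (jtriple (1 + h) y) \<le> (1 + 5 * norm h) * norm y" by (rule norm_jtriple_near_one[OF h])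
  also have "\<dots> \<le> G * (G ^ n * norm x)" using G y(2) by (intro mult_mono) auto
  finally have 1: "norm (jtriple (1 + h) y) \<le> G ^ Suc n * norm x" by (simp add: mult.assoc)
  let ?u = "jtriple (1 + h) 1"
  have u: "norm ?u \<le> 1 + 5 * norm h"
    using norm_jtriple_near_one[OF h, of 1] mult_left_le[OF norm_one_le[where 'a='a], of "1 + 5 * norm h"]
    by (simp del: jtriple_one)
  have "jpositive ((jtriple (1 + h) (y + c *\<^sub>R 1) + (4 * norm h ^ 2 * norm (y + c *\<^sub>R 1)) *\<^sub>R 1)
    + c *\<^sub>R (norm ?u *\<^sub>R 1 - ?u))"
    by (intro jpositive_add jpositive_scaleR c jpositive_norm_minus jpositive_jtriple_near_one y)
  then have "jpositive (jtriple (1 + h) y + (e * norm (y + c *\<^sub>R 1) + c * norm ?u) *\<^sub>R 1)"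
    by (simp add: jtriple_lin e_def algebra_simps del: jtriple_one)
  then have "jpositive (jtriple (1 + h) y + (Suc n * e * G ^ Suc n * norm x) *\<^sub>R 1)"
  proof (rule jpositive_add_one_mono)
    have "e * norm (y + c *\<^sub>R 1) + c * norm ?u \<le> e * (G ^ n * norm x + c) + c * (1 + 5 * norm h)"
      using e c ny u by (intro add_mono mult_left_mono)
    also have "\<dots> = e * G ^ n * norm x + c * (1 + 5 * norm h + e)" by (simp add: algebra_simps)
    also have "\<dots> \<le> e * (G * G ^ n) * norm x + c * G"
      using e c G by (intro add_mono mult_left_mono mult_right_mono) auto
    also have "\<dots> = Suc n * e * G ^ Suc n * norm x" by (simp add: c_def algebra_simps)
    finally show "e * norm (y + c *\<^sub>R 1) + c * norm ?u \<le> Suc n * e * G ^ Suc n * norm x" .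
  qed
  with 1 show ?case by (simp add: y_def e_def)
qed

lemma abs_exp_minus_one_le: "\<bar>exp y - 1\<bar> \<le> \<bar>y\<bar> * exp \<bar>y\<bar>" for y :: real
proof (cases "y \<ge> 0")
  case True
  have "(1 + - y) * exp y \<le> exp (- y) * exp y" by (intro mult_right_mono exp_ge_add_one_self) auto
  then have "exp y - 1 \<le> y * exp y" by (simp add: algebra_simps flip: exp_add)
  then show ?thesis using True by simp
next
  case False
  have "1 - exp y \<le> - y * 1" using exp_ge_add_one_self[of y] by linarith
  also have "\<dots> \<le> - y * exp (- y)" using False by (intro mult_left_mono) auto
  finally show ?thesis using False by simp
qed

text \<open>The roots \<open>r k\<close> of order \<open>2\<^sup>k\<close> satisfy \<open>U(r k)\<^bsup>2^k\<^esup> = U(a)\<close>, since \<open>U(r\<^sup>2) = U(r)\<^sup>2\<close>, and differ from \<open>1\<close>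
  by \<open>O(2\<^sup>-\<^sup>k)\<close>, since \<open>ln\<close> is bounded on the spectrum. The error of the iteration tends to zero.\<close>

theorem jpositive_jtriple:
  assumes a: "a \<in> jpos_cone" and x: "jpositive x"
  shows "jpositive (jtriple a x)"
proof -
  define r where "r k = a jpowr (1 / 2 ^ k)" for k :: nat
  define h where "h k = r k - 1" for k
  have rr: "r (Suc k) \<odot> r (Suc k) = r k" for k
    unfolding r_def by (simp add: jpowr_mult[OF a] field_simps)
  have tr: "(jtriple (r k) ^^ 2 ^ k) x = jtriple a x" for k
  proof (induction k)
    case 0
    then show ?case by (simp add: r_def jpowr_one[OF a])
  next
    case (Suc k)
    have "jtriple (r k) = (jtriple (r (Suc k)) ^^ 2)"
      using jtriple_mult_jgen[OF jgen_self, of "r (Suc k)"] by (auto simp: rr numeral_2_eq_2)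
    then have "(jtriple (r k) ^^ 2 ^ k) x = (jtriple (r (Suc k)) ^^ 2 ^ Suc k) x"
      by (simp add: funpow_mult mult.commute)
    with Suc show ?case by simp
  qed
  have "continuous_on (jspectrum a) ln" using spectrum_pos[OF a] by (auto intro!: continuous_intros)
  then have "bounded (ln ` jspectrum a)"
    by (intro compact_imp_bounded compact_continuous_image compact_jspectrum)
  then obtain L where L: "L > 0" "\<And>t. t \<in> jspectrum a \<Longrightarrow> \<bar>ln t\<bar> \<le> L"
    unfolding bounded_pos by auto
  define K where "K = L * exp L"
  have K: "K > 0" using L by (simp add: K_def)
  have hk: "norm (h k) \<le> K / 2 ^ k" for k
  proof -
    have "h k = jfun_calc (\<lambda>t. t powr (1 / 2 ^ k) + (- 1)) a"
      unfolding h_def r_def jpowr_def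
      by (subst jfun_calc_add) (auto simp: jfun_calc_const continuous_on_spectrum_powr[OF a])
    also have "norm \<dots> \<le> K / 2 ^ k"
    proof (rule norm_jfun_calc_le)
      show "continuous_on (jspectrum a) (\<lambda>t. t powr (1 / 2 ^ k) + (- 1))"
        by (intro continuous_on_add continuous_on_spectrum_powr a continuous_on_const)
      show "0 \<le> K / 2 ^ k" using K by simp
      fix t assume t: "t \<in> jspectrum a"
      let ?s = "(1 / 2 ^ k) * ln t"
      have "\<bar>t powr (1 / 2 ^ k) + (- 1)\<bar> \<le> \<bar>?s\<bar> * exp \<bar>?s\<bar>"
        using abs_exp_minus_one_le[of ?s] spectrum_pos[OF a t] by (simp add: powr_def)
      also have "\<dots> \<le> (L / 2 ^ k) * exp L"
      proof (rule mult_mono)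
        show s: "\<bar>?s\<bar> \<le> L / 2 ^ k" using L(2)[OF t] by (simp add: abs_mult divide_right_mono)
        have "L / 2 ^ k \<le> L" using L(1) by (simp add: field_simps)
        then show "exp \<bar>?s\<bar> \<le> exp L" using s by simp
      qed (use L in auto)
      finally show "\<bar>t powr (1 / 2 ^ k) + (- 1)\<bar> \<le> K / 2 ^ k" by (simp add: K_def)
    qed
    finally show ?thesis .
  qed
  define c where "c k = 4 * K\<^sup>2 * exp (9 * K) * norm x / 2 ^ k" for k :: nat
  have c0: "c \<longlonglongrightarrow> 0" unfolding c_def by (rule LIMSEQ_divide_realpow_zero) simp
  have "(\<lambda>k. K / 2 ^ k) \<longlonglongrightarrow> 0" by (rule LIMSEQ_divide_realpow_zero) simp
  then have "\<forall>\<^sub>F k in sequentially. K / 2 ^ k < 1" by (rule order_tendstoD) simp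
  then have "\<forall>\<^sub>F k in sequentially. jpositive (jtriple a x + c k *\<^sub>R 1)"
  proof eventually_elim
    case (elim k)
    then have h1: "norm (h k) \<le> 1" using hk[of k] by linarith
    have "jpositive ((jtriple (1 + h k) ^^ 2 ^ k) x
        + (real (2 ^ k) * (4 * norm (h k) ^ 2) * (1 + 9 * norm (h k)) ^ 2 ^ k * norm x) *\<^sub>R 1)"
      using jpositive_jtriple_iterate[OF x h1, of "2 ^ k"] by blast
    also have "1 + h k = r k" by (simp add: h_def)
    finally have "jpositive (jtriple a x
        + (real (2 ^ k) * (4 * norm (h k) ^ 2) * (1 + 9 * norm (h k)) ^ 2 ^ k * norm x) *\<^sub>R 1)"
      unfolding tr .
    then show ?case
    proof (rule jpositive_add_one_mono)
      have "(1 + 9 * norm (h k)) ^ 2 ^ k \<le> exp (9 * norm (h k)) ^ 2 ^ k"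
        by (intro power_mono exp_ge_add_one_self) (simp add: add_nonneg_nonneg)
      also have "\<dots> = exp (9 * (2 ^ k * norm (h k)))" by (simp flip: exp_of_nat_mult add: algebra_simps)
      also have "\<dots> \<le> exp (9 * K)" using hk[of k] by (simp add: field_simps)
      finally have G: "(1 + 9 * norm (h k)) ^ 2 ^ k \<le> exp (9 * K)" .
      have "real (2 ^ k) * (4 * norm (h k) ^ 2) * (1 + 9 * norm (h k)) ^ 2 ^ k * norm x
        \<le> 2 ^ k * (4 * (K / 2 ^ k) ^ 2) * exp (9 * K) * norm x"
        using hk[of k] G K by (intro mult_right_mono mult_mono mult_left_mono power_mono) auto
      also have "\<dots> = c k" by (simp add: c_def power2_eq_square field_simps)
      finally show "real (2 ^ k) * (4 * norm (h k) ^ 2) * (1 + 9 * norm (h k)) ^ 2 ^ k * norm x \<le> c k" .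
    qed
  qed
  moreover have "(\<lambda>k. jtriple a x + c k *\<^sub>R 1) \<longlonglongrightarrow> jtriple a x + 0 *\<^sub>R 1"
    by (intro tendsto_intros c0)
  ultimately have "jpositive (jtriple a x + 0 *\<^sub>R 1)" by (rule jpositive_limit[rotated])
  then show ?thesis by simp
qed

text \<open>If \<open>b \<ge> e\<close> then \<open>U(a) b \<ge> e a\<^sup>2\<close>, and \<open>a\<^sup>2\<close> lies in the cone.\<close>

lemma jtriple_in_cone:
  assumes a: "a \<in> jpos_cone" and b: "b \<in> jpos_cone"
  shows "jtriple a b \<in> jpos_cone"
proof -
  obtain e where e: "e > 0" "jpositive (b - e *\<^sub>R 1)" using b jpos_cone_iff by auto
  have "a \<odot> a = a jpowr 2" using jpowr_mult[OF a, of 1 1] by (simp add: jpowr_one[OF a])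
  then have "e *\<^sub>R (a \<odot> a) \<in> jpos_cone" using jpowr_in_cone[OF a] jpos_cone_scaleR e by metis
  then have "e *\<^sub>R (a \<odot> a) + jtriple a (b - e *\<^sub>R 1) \<in> jpos_cone"
    by (intro jpos_cone_add jpositive_jtriple a e)
  then show ?thesis by (simp add: jtriple_lin)
qed

section \<open>Differentiability of power series and the Lie-Trotter limit\<close>

primrec jpower_deriv :: "'a::unital_jb_algebra \<Rightarrow> nat \<Rightarrow> 'a \<Rightarrow> 'a" where
  "jpower_deriv x 0 h = 0"
| "jpower_deriv x (Suc n) h = x \<odot> jpower_deriv x n h + h \<odot> jpower x n"

lemma jpower_has_derivative: "((\<lambda>x. jpower x n) has_derivative jpower_deriv x n) (at x within S)"
proof (induction n)
  case (Suc n)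
  have "jpower_deriv x (Suc n) = (\<lambda>h. x \<odot> jpower_deriv x n h + h \<odot> jpower x n)" by auto
  then show ?case using jprod.FDERIV[OF has_derivative_ident Suc] by simp
qed simp

lemma norm_jpower_le: "norm (jpower x n) \<le> norm x ^ n"
proof (induction n)
  case (Suc n)
  then show ?case
    using order_trans[OF norm_jprod_le[of x "jpower x n"] mult_left_mono[OF Suc]] by simp
qed (simp add: norm_one_le)

lemma norm_jpower_deriv_le:
  assumes "norm x \<le> r"
  shows "norm (jpower_deriv x n h) \<le> (real n * r ^ (n - 1)) * norm h"
proof (induction n)
  case (Suc n)
  have r: "0 \<le> r" using assms norm_ge_zero order_trans by blast
  have "norm (jpower_deriv x (Suc n) h) \<le> norm (x \<odot> jpower_deriv x n h) + norm (h \<odot> jpower x n)"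
    by (simp add: norm_triangle_ineq)
  also have "norm (x \<odot> jpower_deriv x n h) \<le> r * ((real n * r ^ (n - 1)) * norm h)"
    using Suc assms r by (intro order_trans[OF norm_jprod_le] mult_mono) auto
  also have "norm (h \<odot> jpower x n) \<le> norm h * r ^ n"
    using assms norm_jpower_le[of x n] power_mono[OF assms, of n]
    by (intro order_trans[OF norm_jprod_le] mult_left_mono) auto
  finally show ?case by (cases n) (simp_all add: algebra_simps)
qed simp

lemma jpower_deriv_zero: "jpower_deriv 0 n h = (if n = 1 then h else 0)"
  by (cases n; cases "n - 1") auto

lemma jpoly_monom: "jpoly (monom c n) a = c *\<^sub>R jpower a n"
  by (induction n) (simp_all add: monom_0 monom_Suc jprod_lin)

lemma jpoly_sum: "jpoly (\<Sum>i\<in>I. p i) a = (\<Sum>i\<in>I. jpoly (p i) a)"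
  by (induction I rule: infinite_finite_induct) (simp_all add: jpoly_add)

text \<open>The partial sums are polynomials that converge uniformly on the spectrum, because the spectrum
  lies in \<open>[- \<parallel>x\<parallel>, \<parallel>x\<parallel>]\<close>.\<close>

lemma jfun_calc_sums:
  assumes f: "\<And>t. \<bar>t\<bar> < R \<Longrightarrow> (\<lambda>n. c n * t ^ n) sums f t" and x: "norm x < R"
  shows "(\<lambda>n. c n *\<^sub>R jpower x n) sums jfun_calc f x"
proof -
  define s where "s = (norm x + R) / 2"
  have s: "norm x < s" "\<bar>s\<bar> < R" using x norm_ge_zero[of x] by (auto simp: s_def simp del: norm_ge_zero)
  have sm: "summable (\<lambda>n. norm (c n * norm x ^ n))"
    using s norm_ge_zero[of x] by (intro powser_insidea[OF sums_summable[OF f[OF s(2)]]]) auto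
  have "uniform_limit (jspectrum x) (\<lambda>n t. \<Sum>i<n. c i * t ^ i) (\<lambda>t. \<Sum>i. c i * t ^ i) sequentially"
  proof (rule Weierstrass_m_test[OF _ sm])
    fix n t assume "t \<in> jspectrum x"
    from jspectrum_bound[OF this] show "norm (c n * t ^ n) \<le> norm (c n * norm x ^ n)"
      by (auto simp: abs_mult power_abs intro!: mult_left_mono power_mono)
  qed
  also have "(\<lambda>n t. \<Sum>i<n. c i * t ^ i) = (\<lambda>n. poly (\<Sum>i<n. monom (c i) i))"
    by (simp add: fun_eq_iff poly_sum poly_monom)
  finally have "uniform_limit (jspectrum x) (\<lambda>n. poly (\<Sum>i<n. monom (c i) i)) f sequentially"
  proof (rule uniform_limit_cong'[THEN iffD1, rotated -1])
    show "(\<Sum>i. c i * t ^ i) = f t" if "t \<in> jspectrum x" for t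
      using jspectrum_bound[OF that] x by (intro sums_unique[symmetric] f) linarith
  qed auto
  from jfun_calc_tendsto[OF this] show ?thesis
    by (simp add: sums_def jpoly_sum jpoly_monom)
qed

text \<open>The derivative of the \<open>n\<close>-th Jordan power has norm at most \<open>n \<parallel>x\<parallel>\<^sup>n\<^sup>-\<^sup>1\<close>, so the series of derivatives
  is dominated by the derived scalar series and converges uniformly on smaller balls.\<close>

lemma jfun_calc_has_derivative:
  assumes f: "\<And>t. \<bar>t\<bar> < R \<Longrightarrow> (\<lambda>n. c n * t ^ n) sums f t" and x: "norm (x::'a::unital_jb_algebra) < R"
  obtains D where "(jfun_calc f has_derivative D) (at x)" "x = 0 \<Longrightarrow> D = (\<lambda>h. c 1 *\<^sub>R h)"
proof -
  define r where "r = (norm x + R) / 2"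
  define s where "s = (r + R) / 2"
  have r: "norm x < r" "0 < r" "r < s" "s < R"
    using x norm_ge_zero[of x] by (auto simp: r_def s_def simp del: norm_ge_zero)
  define M where "M n = \<bar>c n\<bar> * (real n * r ^ (n - 1))" for n
  have "summable (\<lambda>n. diffs c n * s ^ n)"
    using r sums_summable[OF f] by (intro termdiff_converges[of _ R]) auto
  then have "summable (\<lambda>n. norm (diffs c n * r ^ n))"
    by (rule powser_insidea) (use r in auto)
  also have "(\<lambda>n. norm (diffs c n * r ^ n)) = (\<lambda>n. M (Suc n))"
    using r by (auto simp: M_def diffs_def abs_mult)
  finally have M: "summable M" by (simp add: summable_Suc_iff)
  define D where "D y h = (\<Sum>n. c n *\<^sub>R jpower_deriv y n h)" for y h :: 'a
  have bd: "norm (c n *\<^sub>R jpower_deriv y n h) \<le> M n * norm h" if "norm y \<le> r" for n and y h :: 'a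
    using mult_left_mono[OF norm_jpower_deriv_le[OF that, of n h], of "\<bar>c n\<bar>"] by (simp add: M_def mult.assoc)
  have "\<exists>g. \<forall>y\<in>ball 0 r. (\<lambda>n. c n *\<^sub>R jpower y n) sums g y \<and> (g has_derivative D y) (at y within ball 0 r)"
  proof (rule has_derivative_series)
    show "((\<lambda>y. c n *\<^sub>R jpower y n) has_derivative (\<lambda>h. c n *\<^sub>R jpower_deriv y n h)) (at y within ball 0 r)" for n y
      by (intro has_derivative_scaleR_right jpower_has_derivative)
    show "x \<in> ball 0 r" using r by simp
    show "(\<lambda>n. c n *\<^sub>R jpower x n) sums jfun_calc f x" by (rule jfun_calc_sums[OF f x])
    fix e :: real assume "e > 0"
    from suminf_exist_split[OF this M] obtain N where N: "\<And>n. n \<ge> N \<Longrightarrow> \<bar>\<Sum>i. M (i + n)\<bar> < e" by auto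
    show "\<forall>\<^sub>F n in sequentially. \<forall>y\<in>ball 0 r. \<forall>h.
       norm ((\<Sum>i<n. c i *\<^sub>R jpower_deriv y i h) - D y h) \<le> e * norm h"
      unfolding eventually_sequentially
    proof (intro exI allI impI ballI)
      fix n and y h :: 'a assume n: "N \<le> n" and "y \<in> ball 0 r"
      then have y: "norm y \<le> r" by simp
      have sm: "summable (\<lambda>i. M i * norm h)" by (rule summable_mult2[OF M])
      then have sm': "summable (\<lambda>i. c i *\<^sub>R jpower_deriv y i h)"
        by (rule summable_comparison_test'[where N = 0]) (use bd[OF y] in auto)
      have "(\<Sum>i<n. c i *\<^sub>R jpower_deriv y i h) - D y h = - (\<Sum>i. c (i + n) *\<^sub>R jpower_deriv y (i + n) h)"
        unfolding D_def using suminf_minus_initial_segment[OF sm', of n] by simp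
      then have "norm ((\<Sum>i<n. c i *\<^sub>R jpower_deriv y i h) - D y h)
          = norm (\<Sum>i. c (i + n) *\<^sub>R jpower_deriv y (i + n) h)" by simp
      also have "\<dots> \<le> (\<Sum>i. M (i + n) * norm h)"
      proof -
        have S: "summable (\<lambda>i. M (i + n) * norm h)" using sm by (rule summable_ignore_initial_segment)
        then have S': "summable (\<lambda>i. norm (c (i + n) *\<^sub>R jpower_deriv y (i + n) h))"
          by (rule summable_comparison_test'[where N = 0]) (use bd[OF y] in auto)
        show ?thesis using bd[OF y] by (intro order_trans[OF summable_norm[OF S'] suminf_le[OF _ S' S]])
      qed
      also have "\<dots> = (\<Sum>i. M (i + n)) * norm h"
        using M by (intro suminf_mult2[symmetric]) (simp add: summable_iff_shift)
      also have "\<dots> \<le> e * norm h" using N[OF n] by (intro mult_right_mono) auto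
      finally show "norm ((\<Sum>i<n. c i *\<^sub>R jpower_deriv y i h) - D y h) \<le> e * norm h" .
    qed
  qed simp
  then obtain g where g: "\<And>y. norm y < r \<Longrightarrow> (\<lambda>n. c n *\<^sub>R jpower y n) sums g y"
    "(g has_derivative D x) (at x within ball 0 r)" using r by fastforce
  have "(g has_derivative D x) (at x)" using g(2) r by (subst (asm) at_within_open) auto
  then have "(jfun_calc f has_derivative D x) (at x)"
  proof (rule has_derivative_transform_within_open[of _ _ _ _ "ball 0 r"])
    show "g y = jfun_calc f y" if "y \<in> ball 0 r" for y
      using that r by (intro sums_unique2[OF g(1) jfun_calc_sums[OF f]]) auto
  qed (use r in auto)
  moreover have "D x = (\<lambda>h. c 1 *\<^sub>R h)" if "x = 0"
  proof
    fix h
    have "D x h = (\<Sum>n. if n = 1 then c 1 *\<^sub>R h else 0)"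
      unfolding D_def that jpower_deriv_zero by (intro suminf_cong) auto
    also have "\<dots> = c 1 *\<^sub>R h" using sums_unique[OF sums_single[of 1 "\<lambda>n. c 1 *\<^sub>R h"]] by simp
    finally show "D x h = c 1 *\<^sub>R h" .
  qed
  ultimately show ?thesis using that by blast
qed

lemma isCont_jexp: "isCont jexp (a::'a::unital_jb_algebra)"
proof -
  have e: "(\<lambda>n. inverse (fact n) * t ^ n) sums exp t" for t :: real
    using exp_converges[of t] by (simp add: scaleR_conv_of_real)
  obtain D where "(jfun_calc exp has_derivative D) (at a)"
    using jfun_calc_has_derivative[OF e, of a "norm a + 1"] by auto
  then show ?thesis
    using has_derivative_continuous by (auto simp: jexp_def[abs_def])
qed

text \<open>A function analytic about \<open>M\<close> rather than \<open>0\<close> is reduced to a power series by the substitution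
  \<open>b = M (1 + x)\<close>; the composition rule of the calculus justifies it on the whole cone.\<close>

lemma jfun_calc_has_derivative_cone:
  assumes a: "a \<in> jpos_cone" and M: "M > 0" and near: "norm ((1 / M) *\<^sub>R a - 1) < 1"
    and g: "continuous_on {0<..} g" "\<And>t. \<bar>t\<bar> < 1 \<Longrightarrow> (\<lambda>n. c n * t ^ n) sums g (M * (1 + t))"
  obtains D where "(jfun_calc g has_derivative D) (at a)" "a = M *\<^sub>R 1 \<Longrightarrow> D = (\<lambda>h. (c 1 / M) *\<^sub>R h)"
proof -
  define G where "G t = g (M * (1 + t))" for t
  have eq: "jfun_calc G ((1 / M) *\<^sub>R b - 1) = jfun_calc g b" if "b \<in> jpos_cone" for b
  proof -
    have p: "poly [:-1, 1 / M:] = (\<lambda>x. x / M - 1)" by auto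
    have b: "(1 / M) *\<^sub>R b - 1 = jfun_calc (\<lambda>x. x / M - 1) b"
      using jfun_calc_poly[of "[:-1, 1 / M:]" b] unfolding p by (simp add: jprod_lin)
    have "continuous_on ((\<lambda>x. x / M - 1) ` jspectrum b) G"
      unfolding G_def using spectrum_pos[OF that] M
      by (intro continuous_on_compose2[OF g(1)] continuous_intros) auto
    then have "jfun_calc G ((1 / M) *\<^sub>R b - 1) = jfun_calc (\<lambda>x. G (x / M - 1)) b"
      unfolding b using M by (intro jfun_calc_compose continuous_intros) auto
    also have "\<dots> = jfun_calc g b" using M by (simp add: G_def)
    finally show ?thesis .
  qed
  obtain D where D: "(jfun_calc G has_derivative D) (at ((1 / M) *\<^sub>R a - 1))"
    "(1 / M) *\<^sub>R a - 1 = 0 \<Longrightarrow> D = (\<lambda>h. c 1 *\<^sub>R h)"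
    using jfun_calc_has_derivative[of 1 c G, OF _ near] g(2) unfolding G_def by blast
  have "((\<lambda>b. (1 / M) *\<^sub>R b - 1) has_derivative (\<lambda>h. (1 / M) *\<^sub>R h)) (at a)"
    by (auto intro!: derivative_eq_intros)
  from has_derivative_compose[OF this D(1)]
  have "((\<lambda>b. jfun_calc G ((1 / M) *\<^sub>R b - 1)) has_derivative (\<lambda>h. D ((1 / M) *\<^sub>R h))) (at a)" .
  then have "(jfun_calc g has_derivative (\<lambda>h. D ((1 / M) *\<^sub>R h))) (at a)"
    by (rule has_derivative_transform_within_open[OF _ open_jpos_cone a eq])
  then show ?thesis using that D(2) M by auto
qed

lemma powr_series:
  fixes M t r :: real
  assumes "M > 0" "\<bar>t\<bar> < 1"
  shows "(\<lambda>n. (M powr r * (r gchoose n)) * t ^ n) sums (M * (1 + t)) powr r"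
  using sums_mult[OF gen_binomial_real[OF assms(2), of r], of "M powr r"] assms
  by (simp add: powr_mult mult.assoc)

text \<open>With \<open>M > \<parallel>a\<parallel>\<close> the spectrum of \<open>a / M - 1\<close> lies in a compact part of \<open>(-1, 0)\<close>, so the binomial
  series converges there.\<close>

lemma jpowr_differentiable:
  assumes a: "a \<in> jpos_cone"
  shows "(\<lambda>b. b jpowr r) differentiable (at a)"
proof -
  define M where "M = norm a + 1"
  have M: "M > 0" by (simp add: M_def add_nonneg_pos)
  obtain e where e: "e > 0" "\<And>x. x \<in> jspectrum a \<Longrightarrow> e \<le> x" using spectrum_lower_bound[OF a] by blast
  have "norm (jpoly [:-1, 1 / M:] a) \<le> max 0 (1 - e / M)"
  proof (rule norm_jpoly_le)
    fix x assume x: "x \<in> jspectrum a"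
    have "x / M \<le> 1" "e / M \<le> x / M" 
      using jspectrum_bound[OF x] e(2)[OF x] M by (auto simp: M_def divide_simps)
    then show "\<bar>poly [:-1, 1 / M:] x\<bar> \<le> max 0 (1 - e / M)" by simp
  qed simp
  also have "\<dots> < 1" using e M by simp
  finally have n: "norm ((1 / M) *\<^sub>R a - 1) < 1" by (simp add: jprod_lin)
  have c: "continuous_on {0<..} (\<lambda>x::real. x powr r)" by (intro continuous_intros) auto
  obtain D where "(jfun_calc (\<lambda>x. x powr r) has_derivative D) (at a)"
    using jfun_calc_has_derivative_cone[OF a M n c powr_series[OF M]] by blast
  then show ?thesis unfolding jpowr_def differentiable_def by blast
qed

lemma jpowr_derivative_one: "((\<lambda>b. b jpowr r) has_derivative (\<lambda>h. r *\<^sub>R h)) (at 1)"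
proof -
  have c: "continuous_on {0<..} (\<lambda>x::real. x powr r)" by (intro continuous_intros) auto
  show ?thesis
    using jfun_calc_has_derivative_cone[OF jpos_cone_one _ _ c powr_series, of 1] unfolding jpowr_def by auto
qed

lemma jln_derivative_one: "(jfun_calc ln has_derivative (\<lambda>h. h)) (at 1)"
proof -
  have c: "continuous_on {0<..} (ln :: real \<Rightarrow> real)" by (intro continuous_intros) auto
  have "(\<lambda>n. (- ((- 1) ^ n) / of_nat n) * t ^ n) sums ln (1 * (1 + t))" if "\<bar>t\<bar> < 1" for t :: real
    using ln_series'[OF that] by (simp add: power_minus[of t])
  from jfun_calc_has_derivative_cone[OF jpos_cone_one _ _ c this] show ?thesis by auto
qed

lemma jpowr_eq_jexp:
  assumes b: "b \<in> jpos_cone"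
  shows "b jpowr s = jexp (s *\<^sub>R jfun_calc ln b)"
proof -
  have l: "continuous_on (jspectrum b) ln" using spectrum_pos[OF b] by (auto intro!: continuous_intros)
  have "jexp (s *\<^sub>R jfun_calc ln b) = jfun_calc exp (jfun_calc (\<lambda>x. s * ln x) b)"
    by (simp add: jexp_def jfun_calc_scaleR[OF l])
  also have "\<dots> = jfun_calc (\<lambda>x. exp (s * ln x)) b"
    by (rule jfun_calc_compose) (auto intro!: continuous_intros l)
  also have "\<dots> = b jpowr s"
    unfolding jpowr_def by (rule jfun_calc_cong) (use spectrum_pos[OF b] in \<open>force simp: powr_def\<close>)
  finally show ?thesis ..
qed

text \<open>The power is \<open>exp ((c / t) log X t)\<close>, and \<open>log X t / t \<longlongrightarrow> W\<close> by the chain rule; \<open>exp\<close> is continuous.\<close>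

theorem jpowr_tendsto_jexp:
  fixes X :: "real \<Rightarrow> 'a::unital_jb_algebra"
  assumes X: "(X has_vector_derivative W) (at 0)" and X0: "X 0 = 1"
  shows "((\<lambda>t. X t jpowr (c / t)) \<longlongrightarrow> jexp (c *\<^sub>R W)) (at 0)"
proof -
  have ln1: "jfun_calc ln (1::'a) = 0"
  proof -
    have "jfun_calc ln (1::'a) = jfun_calc (\<lambda>x. 0) 1"
      by (intro jfun_calc_cong) (metis jspectrum_one ln_one)
    then show ?thesis by (simp add: jfun_calc_const)
  qed
  have "((\<lambda>t. jfun_calc ln (X t)) has_vector_derivative W) (at 0)"
    using has_derivative_compose[of X _ 0 UNIV "jfun_calc ln" "\<lambda>h. h"] X jln_derivative_one X0
    by (simp add: has_vector_derivative_def)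
  then have "((\<lambda>t. (1 / t) *\<^sub>R jfun_calc ln (X t)) \<longlongrightarrow> W) (at 0)"
  proof -
    assume "((\<lambda>t. jfun_calc ln (X t)) has_vector_derivative W) (at 0)"
    then have "((\<lambda>t. norm (jfun_calc ln (X t) - t *\<^sub>R W) / \<bar>t\<bar>) \<longlongrightarrow> 0) (at 0)"
      by (simp add: has_vector_derivative_def has_derivative_at X0 ln1)
    moreover have "\<forall>\<^sub>F t in at 0. norm (jfun_calc ln (X t) - t *\<^sub>R W) / \<bar>t\<bar>
        = norm ((1 / t) *\<^sub>R jfun_calc ln (X t) - W)"
      unfolding eventually_at_filter
    proof (rule always_eventually, intro allI impI)
      fix t :: real assume t: "t \<noteq> 0"
      have "(1 / t) *\<^sub>R jfun_calc ln (X t) - W = (1 / t) *\<^sub>R (jfun_calc ln (X t) - t *\<^sub>R W)"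
        using t by (simp add: scaleR_diff_right)
      then show "norm (jfun_calc ln (X t) - t *\<^sub>R W) / \<bar>t\<bar> = norm ((1 / t) *\<^sub>R jfun_calc ln (X t) - W)"
        by simp
    qed
    ultimately have "((\<lambda>t. norm ((1 / t) *\<^sub>R jfun_calc ln (X t) - W)) \<longlongrightarrow> 0) (at 0)"
      by (rule Lim_transform_eventually)
    then show ?thesis by (rule LIM_zero_cancel[OF tendsto_norm_zero_cancel])
  qed
  then have "((\<lambda>t. jexp (c *\<^sub>R ((1 / t) *\<^sub>R jfun_calc ln (X t)))) \<longlongrightarrow> jexp (c *\<^sub>R W)) (at 0)"
    by (rule isCont_tendsto_compose[OF isCont_jexp tendsto_scaleR[OF tendsto_const]])
  moreover have "\<forall>\<^sub>F t in at 0. X t \<in> jpos_cone"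
  proof -
    have "isCont X 0" using X by (rule has_vector_derivative_continuous)
    then have "(X \<longlongrightarrow> 1) (at 0)" by (simp add: isCont_def X0)
    then show ?thesis by (rule topological_tendstoD[OF _ open_jpos_cone jpos_cone_one])
  qed
  then have "\<forall>\<^sub>F t in at 0. jexp (c *\<^sub>R ((1 / t) *\<^sub>R jfun_calc ln (X t))) = X t jpowr (c / t)"
    by eventually_elim (simp add: jpowr_eq_jexp)
  ultimately show ?thesis by (rule Lim_transform_eventually)
qed

section \<open>Derivatives of the means along curves\<close>

lemma jinv_in_cone: "a \<in> jpos_cone \<Longrightarrow> jinv a \<in> jpos_cone"
  by (simp add: jinv_eq_jpowr jpowr_in_cone)

lemma fst_snd_differentiable: "fst differentiable (at p)" "snd differentiable (at p)"
  by (simp_all add: bounded_linear_imp_differentiable bounded_linear_fst bounded_linear_snd)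

lemma jprod_differentiable:
  assumes "f differentiable (at x within S)" "g differentiable (at x within S)"
  shows "(\<lambda>x. f x \<odot> g x) differentiable (at x within S)"
  using assms jprod.FDERIV unfolding differentiable_def by blast

lemma jtriple_differentiable:
  assumes "f differentiable (at x within S)" "g differentiable (at x within S)"
  shows "(\<lambda>x. jtriple (f x) (g x)) differentiable (at x within S)"
  unfolding jtriple_def using assms by (intro derivative_intros jprod_differentiable)

lemma jinv_transform:
  assumes "((\<lambda>b. b jpowr - 1) has_derivative D) (at a)" "a \<in> jpos_cone"
  shows "(jinv has_derivative D) (at a)"
  by (rule has_derivative_transform_within_open[OF assms(1) open_jpos_cone assms(2)])
    (simp add: jinv_eq_jpowr)

lemma jinv_differentiable: "a \<in> jpos_cone \<Longrightarrow> jinv differentiable (at a)"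
  using jpowr_differentiable[of a "- 1"] jinv_transform unfolding differentiable_def by blast

context
  fixes X :: "real \<Rightarrow> 'a::unital_jb_algebra" and x :: 'a
  assumes X: "(X has_vector_derivative x) (at 0)" "X 0 = 1"
begin

lemma jpowr_curve: "((\<lambda>t. X t jpowr r) has_vector_derivative r *\<^sub>R x) (at 0)" "X 0 jpowr r = 1"
  using has_derivative_compose[of X "\<lambda>t. t *\<^sub>R x" 0 UNIV "\<lambda>b. b jpowr r" "\<lambda>h. r *\<^sub>R h"] X jpowr_derivative_one[of r]
  by (simp_all add: has_vector_derivative_def one_jpowr mult.commute)

lemma jinv_curve: "((\<lambda>t. jinv (X t)) has_vector_derivative - x) (at 0)" "jinv (X 0) = 1"
  using has_derivative_compose[of X _ 0 UNIV jinv "\<lambda>h. - 1 *\<^sub>R h"] X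
    jinv_transform[OF jpowr_derivative_one[of "- 1"] jpos_cone_one]
  by (simp_all add: has_vector_derivative_def one_jpowr jinv_eq_jpowr jpos_cone_one)

lemma jtriple_curve:
  assumes Y: "(Y has_vector_derivative y) (at 0)" "Y 0 = 1"
  shows "((\<lambda>t. jtriple (X t) (Y t)) has_vector_derivative 2 *\<^sub>R x + y) (at 0)" "jtriple (X 0) (Y 0) = 1"
proof -
  note XY = jprod.has_vector_derivative[OF X(1) Y(1)]
  have "((\<lambda>t. 2 *\<^sub>R ((X t \<odot> Y t) \<odot> X t) - (X t \<odot> X t) \<odot> Y t) has_vector_derivative
    2 *\<^sub>R ((X 0 \<odot> Y 0) \<odot> x + (X 0 \<odot> y + x \<odot> Y 0) \<odot> X 0)
      - ((X 0 \<odot> X 0) \<odot> y + (X 0 \<odot> x + x \<odot> X 0) \<odot> Y 0)) (at 0)"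
    by (intro has_vector_derivative_diff
        bounded_linear.has_vector_derivative[OF bounded_linear_scaleR_right]
        jprod.has_vector_derivative X Y)
  moreover have "2 *\<^sub>R ((X 0 \<odot> Y 0) \<odot> x + (X 0 \<odot> y + x \<odot> Y 0) \<odot> X 0)
      - ((X 0 \<odot> X 0) \<odot> y + (X 0 \<odot> x + x \<odot> X 0) \<odot> Y 0) = 2 *\<^sub>R x + y"
    by (simp add: X Y scaleR_2)
  ultimately show "((\<lambda>t. jtriple (X t) (Y t)) has_vector_derivative 2 *\<^sub>R x + y) (at 0)"
    by (simp add: jtriple_def)
  show "jtriple (X 0) (Y 0) = 1" by (simp add: X Y)
qed

end

lemma unit_curve_has_vector_derivative:
  assumes "e > 0" "unit_curve e X"
  shows "(X has_vector_derivative vector_derivative X (at 0)) (at 0)"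
  using assms by (auto simp: unit_curve_def differentiable_on_eq_differentiable_at vector_derivative_works[symmetric])

text \<open>The limit condition reduces to the derivative of \<open>G\<close> along two curves through \<open>1\<close>.\<close>

lemma lie_trotter_meanI:
  fixes G :: "'a::unital_jb_algebra \<Rightarrow> 'a \<Rightarrow> 'a"
  assumes l: "0 < l" "l < 1"
    and cone: "\<And>A B. A \<in> jpos_cone \<Longrightarrow> B \<in> jpos_cone \<Longrightarrow> G A B \<in> jpos_cone"
    and idem: "\<And>A. A \<in> jpos_cone \<Longrightarrow> G A A = A"
    and diff: "\<And>A B. A \<in> jpos_cone \<Longrightarrow> B \<in> jpos_cone \<Longrightarrow> (\<lambda>p. G (fst p) (snd p)) differentiable (at (A, B))"
    and curve: "\<And>X Y x y. (X has_vector_derivative x) (at 0) \<Longrightarrow> X 0 = 1 \<Longrightarrow>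
      (Y has_vector_derivative y) (at 0) \<Longrightarrow> Y 0 = 1 \<Longrightarrow>
      ((\<lambda>t. G (X t) (Y t)) has_vector_derivative (1 - l) *\<^sub>R x + l *\<^sub>R y) (at 0)"
  shows "lie_trotter_mean l G"
proof -
  have "(\<lambda>(A, B). G A B) differentiable_on (jpos_cone \<times> jpos_cone)"
    unfolding case_prod_beta' using diff by (auto simp: differentiable_on_def intro: differentiable_at_withinI)
  moreover have "((\<lambda>t. G (X t) (Y t) jpowr (1 / t)) \<longlongrightarrow>
      jexp ((1 - l) *\<^sub>R vector_derivative X (at 0) + l *\<^sub>R vector_derivative Y (at 0))) (at 0)"
    if "e > 0" "unit_curve e X" "unit_curve e Y" for e X Y
  proof -
    have "((\<lambda>t. G (X t) (Y t)) has_vector_derivative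
        (1 - l) *\<^sub>R vector_derivative X (at 0) + l *\<^sub>R vector_derivative Y (at 0)) (at 0)"
      using that by (intro curve unit_curve_has_vector_derivative) (auto simp: unit_curve_def)
    from jpowr_tendsto_jexp[OF this, of 1] show ?thesis
      using that idem[OF jpos_cone_one] by (simp add: unit_curve_def)
  qed
  ultimately show ?thesis
    unfolding lie_trotter_mean_def weighted_two_mean_def using l cone idem by blast
qed

section \<open>The four means\<close>

lemma arith_mean_same: "arith_mean l A A = A"
  by (simp add: arith_mean_def flip: scaleR_left_distrib)

lemma arith_mean_curve:
  assumes "(X has_vector_derivative x) F" "(Y has_vector_derivative y) F"
  shows "((\<lambda>t. arith_mean l (X t) (Y t)) has_vector_derivative arith_mean l x y) F"
  unfolding arith_mean_def using assms
  by (intro has_vector_derivative_add bounded_linear.has_vector_derivative[OF bounded_linear_scaleR_right])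

lemma harm_mean_eq: "harm_mean l A B = jinv (arith_mean l (jinv A) (jinv B))"
  by (simp add: harm_mean_def arith_mean_def)

lemma jinv_jinv: "a \<in> jpos_cone \<Longrightarrow> jinv (jinv a) = a"
  by (simp add: jinv_eq_jpowr jpowr_in_cone jpowr_jpowr jpowr_one)

lemma geo_mean_in_cone:
  "A \<in> jpos_cone \<Longrightarrow> B \<in> jpos_cone \<Longrightarrow> geo_mean r A B \<in> jpos_cone"
  unfolding geo_mean_def by (intro jtriple_in_cone jpowr_in_cone)

lemma geo_mean_same:
  assumes A: "A \<in> jpos_cone" shows "geo_mean r A A = A"
proof -
  have "jtriple (A jpowr (- 1 / 2)) A = 1"
    using jpowr_mult[OF A, of "- 1" 1]
    by (simp add: jtriple_jgen[OF jpowr_in_jgen[OF A] jgen_self] jpowr_mult[OF A] jpowr_one[OF A] jpowr_zero[OF A])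
  then show ?thesis
    by (simp add: geo_mean_def one_jpowr jpowr_mult[OF A] jpowr_one[OF A])
qed

text \<open>The triple product doubles the derivative of its outer variable. So the exponent \<open>1/2\<close> contributes
  \<open>x\<close>, and the exponent \<open>-1/2\<close> inside the power \<open>r\<close> contributes \<open>- r x\<close>.\<close>

lemma geo_mean_curve:
  assumes X: "(X has_vector_derivative x) (at 0)" "X 0 = 1" and Y: "(Y has_vector_derivative y) (at 0)" "Y 0 = 1"
  shows "((\<lambda>t. geo_mean r (X t) (Y t)) has_vector_derivative (1 - r) *\<^sub>R x + r *\<^sub>R y) (at 0)"
    "geo_mean r (X 0) (Y 0) = 1"
proof -
  note 1 = jtriple_curve[OF jpowr_curve[OF X, of "- 1 / 2"] Y]
  note 2 = jtriple_curve[OF jpowr_curve[OF X, of "1 / 2"] jpowr_curve[OF 1, of r]]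
  show "((\<lambda>t. geo_mean r (X t) (Y t)) has_vector_derivative (1 - r) *\<^sub>R x + r *\<^sub>R y) (at 0)"
    using 2(1) by (simp add: geo_mean_def algebra_simps)
  show "geo_mean r (X 0) (Y 0) = 1" using 2(2) by (simp add: geo_mean_def)
qed

lemma jpowr_compose_differentiable:
  assumes "f differentiable (at p)" "f p \<in> jpos_cone"
  shows "(\<lambda>p. f p jpowr r) differentiable (at p)"
  using assms by (intro differentiable_compose[of "\<lambda>b. b jpowr r" f] jpowr_differentiable)

lemma geo_mean_differentiable:
  assumes "f differentiable (at p)" "f p \<in> jpos_cone" "g differentiable (at p)" "g p \<in> jpos_cone"
  shows "(\<lambda>p. geo_mean r (f p) (g p)) differentiable (at p)"
  unfolding geo_mean_def using assms
  by (intro jtriple_differentiable jpowr_compose_differentiable jtriple_in_cone jpowr_in_cone)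

context
  fixes l :: real
  assumes l: "0 < l" "l < 1"
begin

lemma arith_mean_in_cone:
  "A \<in> jpos_cone \<Longrightarrow> B \<in> jpos_cone \<Longrightarrow> arith_mean l A B \<in> jpos_cone"
  unfolding arith_mean_def using l by (intro jpos_cone_add jpos_cone_scaleR jpos_cone_jpositive) auto

lemma lie_trotter_arith: "lie_trotter_mean l (arith_mean l :: 'a::unital_jb_algebra \<Rightarrow> _)"
proof (rule lie_trotter_meanI)
  show "(\<lambda>p. arith_mean l (fst p) (snd p)) differentiable (at (A, B))" for A B :: 'a
    unfolding arith_mean_def
    by (intro differentiable_add differentiable_scaleR differentiable_const fst_snd_differentiable)
qed (use l arith_mean_in_cone arith_mean_same arith_mean_curve in \<open>auto simp: arith_mean_def\<close>)

lemma lie_trotter_harm: "lie_trotter_mean l (harm_mean l :: 'a::unital_jb_algebra \<Rightarrow> _)"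
proof (rule lie_trotter_meanI)
  show "(\<lambda>p. harm_mean l (fst p) (snd p)) differentiable (at (A, B))"
    if "A \<in> jpos_cone" "B \<in> jpos_cone" for A B :: 'a
    unfolding harm_mean_eq
  proof (rule differentiable_compose[of jinv "\<lambda>p. arith_mean l (jinv (fst p)) (jinv (snd p))"])
    show "jinv differentiable at (arith_mean l (jinv (fst (A, B))) (jinv (snd (A, B))))"
      using that by (simp add: jinv_differentiable arith_mean_in_cone jinv_in_cone)
    show "(\<lambda>p. arith_mean l (jinv (fst p)) (jinv (snd p))) differentiable (at (A, B))"
      unfolding arith_mean_def using that
      by (intro differentiable_add differentiable_scaleR differentiable_const
          differentiable_compose[of jinv fst] differentiable_compose[of jinv snd]
          fst_snd_differentiable)
        (auto intro: jinv_differentiable)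
  qed
  show "((\<lambda>t. harm_mean l (X t) (Y t)) has_vector_derivative (1 - l) *\<^sub>R x + l *\<^sub>R y) (at 0)"
    if "(X has_vector_derivative x) (at 0)" "X 0 = 1" "(Y has_vector_derivative y) (at 0)" "Y 0 = 1"
    for X Y and x y :: 'a
    using jinv_curve(1)[OF arith_mean_curve[OF jinv_curve(1)[OF that(1,2)] jinv_curve(1)[OF that(3,4)]]]
    by (simp add: harm_mean_eq jinv_curve(2)[OF that(1,2)] jinv_curve(2)[OF that(3,4)] arith_mean_same)
       (simp add: arith_mean_def algebra_simps)
qed (use l in \<open>simp_all add: harm_mean_eq jinv_in_cone jinv_jinv arith_mean_in_cone arith_mean_same\<close>)

lemma lie_trotter_geo: "lie_trotter_mean l (geo_mean l :: 'a::unital_jb_algebra \<Rightarrow> _)"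
proof (rule lie_trotter_meanI)
  show "(\<lambda>p. geo_mean l (fst p) (snd p)) differentiable (at (A, B))"
    if "A \<in> jpos_cone" "B \<in> jpos_cone" for A B :: 'a
    using that by (intro geo_mean_differentiable fst_snd_differentiable) auto
qed (use l geo_mean_in_cone geo_mean_same geo_mean_curve in auto)

lemma lie_trotter_spectral: "lie_trotter_mean l (spectral_geo_mean l :: 'a::unital_jb_algebra \<Rightarrow> _)"
proof (rule lie_trotter_meanI)
  show "spectral_geo_mean l A B \<in> jpos_cone" if "A \<in> jpos_cone" "B \<in> jpos_cone" for A B :: 'a
    unfolding spectral_geo_mean_def
    using that by (intro jtriple_in_cone jpowr_in_cone geo_mean_in_cone jinv_in_cone)
  show "spectral_geo_mean l A A = A" if A: "A \<in> jpos_cone" for A :: 'a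
  proof -
    have "jtriple (jinv A jpowr (- 1 / 2)) A = A jpowr 2"
      using jpowr_mult[OF A, of 1 1]
      by (simp add: jinv_eq_jpowr[OF A] jpowr_jpowr[OF A] jpowr_one[OF A]
          jtriple_jgen[OF jpowr_in_jgen[OF A] jgen_self] jpowr_mult[OF A])
    then have "geo_mean (1 / 2) (jinv A) A = jtriple (A jpowr (- 1 / 2)) A"
      by (simp add: geo_mean_def jpowr_jpowr[OF A] jpowr_one[OF A]) (simp add: jinv_eq_jpowr[OF A] jpowr_jpowr[OF A])
    also have "\<dots> = 1"
      using jpowr_mult[OF A, of "- 1" 1]
      by (simp add: jtriple_jgen[OF jpowr_in_jgen[OF A] jgen_self] jpowr_mult[OF A] jpowr_one[OF A] jpowr_zero[OF A])
    finally show ?thesis by (simp add: spectral_geo_mean_def one_jpowr)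
  qed
  show "(\<lambda>p. spectral_geo_mean l (fst p) (snd p)) differentiable (at (A, B))"
    if "A \<in> jpos_cone" "B \<in> jpos_cone" for A B :: 'a
    unfolding spectral_geo_mean_def using that
    by (intro jtriple_differentiable jpowr_compose_differentiable geo_mean_differentiable
        differentiable_compose[of jinv fst] fst_snd_differentiable)
      (auto intro: jinv_differentiable jinv_in_cone geo_mean_in_cone)
  show "((\<lambda>t. spectral_geo_mean l (X t) (Y t)) has_vector_derivative (1 - l) *\<^sub>R x + l *\<^sub>R y) (at 0)"
    if X: "(X has_vector_derivative x) (at 0)" "X 0 = 1" and Y: "(Y has_vector_derivative y) (at 0)" "Y 0 = 1"
    for X Y and x y :: 'a
    using jtriple_curve(1)[OF jpowr_curve[OF geo_mean_curve[OF jinv_curve[OF X] Y, of "1/2"], of l] X]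
    by (simp add: spectral_geo_mean_def algebra_simps)
qed (use l in auto)

end

theorem mainTheorem1:
  fixes l :: real
  assumes "0 < l" and "l < 1"
  shows "lie_trotter_mean l (arith_mean l :: 'a::unital_jb_algebra \<Rightarrow> 'a \<Rightarrow> 'a)
    \<and> lie_trotter_mean l (harm_mean l :: 'a \<Rightarrow> 'a \<Rightarrow> 'a)
    \<and> lie_trotter_mean l (geo_mean l :: 'a \<Rightarrow> 'a \<Rightarrow> 'a)
    \<and> lie_trotter_mean l (spectral_geo_mean l :: 'a \<Rightarrow> 'a \<Rightarrow> 'a)
    \<and> (\<forall>e>0. \<forall>(\<gamma>1 :: real \<Rightarrow> 'a) \<gamma>2. unit_curve e \<gamma>1 \<and> unit_curve e \<gamma>2 \<longrightarrow>
        (let E = jexp ((1 - l) *\<^sub>R vector_derivative \<gamma>1 (at 0) + l *\<^sub>R vector_derivative \<gamma>2 (at 0)) in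
          ((\<lambda>t. ((1 - l) *\<^sub>R \<gamma>1 t + l *\<^sub>R \<gamma>2 t) jpowr (1 / t)) \<longlongrightarrow> E) (at 0)
        \<and> ((\<lambda>t. ((1 - l) *\<^sub>R jinv (\<gamma>1 t) + l *\<^sub>R jinv (\<gamma>2 t)) jpowr (- 1 / t)) \<longlongrightarrow> E) (at 0)
        \<and> ((\<lambda>t. geo_mean l (\<gamma>1 t) (\<gamma>2 t) jpowr (1 / t)) \<longlongrightarrow> E) (at 0)
        \<and> ((\<lambda>t. spectral_geo_mean l (\<gamma>1 t) (\<gamma>2 t) jpowr (1 / t)) \<longlongrightarrow> E) (at 0)))"
proof -
  note means = lie_trotter_arith[OF assms, where 'a='a] lie_trotter_harm[OF assms, where 'a='a]
    lie_trotter_geo[OF assms, where 'a='a] lie_trotter_spectral[OF assms, where 'a='a]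
  have limits: "((\<lambda>t. G (X t) (Y t) jpowr (1 / t)) \<longlongrightarrow>
      jexp ((1 - l) *\<^sub>R vector_derivative X (at 0) + l *\<^sub>R vector_derivative Y (at 0))) (at 0)"
    if "lie_trotter_mean l G" "e > 0" "unit_curve e X" "unit_curve e Y" for G e and X Y :: "real \<Rightarrow> 'a"
    using that by (simp add: lie_trotter_mean_def)
  have harm: "((\<lambda>t. ((1 - l) *\<^sub>R jinv (X t) + l *\<^sub>R jinv (Y t)) jpowr (- 1 / t)) \<longlongrightarrow>
      jexp ((1 - l) *\<^sub>R vector_derivative X (at 0) + l *\<^sub>R vector_derivative Y (at 0))) (at 0)"
    if e: "e > 0" and X: "unit_curve e X" and Y: "unit_curve e Y" for e and X Y :: "real \<Rightarrow> 'a"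
  proof -
    have one: "X 0 = 1" "Y 0 = 1" using X Y by (auto simp: unit_curve_def)
    note iX = jinv_curve[OF unit_curve_has_vector_derivative[OF e X] one(1)]
    note iY = jinv_curve[OF unit_curve_has_vector_derivative[OF e Y] one(2)]
    have "arith_mean l (jinv (X 0)) (jinv (Y 0)) = 1"
      using iX(2) iY(2) by (simp add: arith_mean_same)
    from jpowr_tendsto_jexp[OF arith_mean_curve[OF iX(1) iY(1)] this, of "- 1"]
    show ?thesis by (simp add: arith_mean_def add.commute)
  qed
  show ?thesis
    using means harm limits[OF means(1)] limits[OF means(3)] limits[OF means(4)]
    unfolding Let_def arith_mean_def by blast
qed

end
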